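(* With high probability (i.e. with probability tending to $1$ as $n\to\infty$), $$\frac{1}{2}\log n - \left(3+o(1)\right)\log\ln n \;\leqslant\; \chi_c\left(G\left(n,\tfrac{1}{2}\right)\right)\;\leqslant\; \frac{1}{2}\log n - \left(\frac{1}{2}-o(1)\right) \log\ln n,$$ that is, for every $\delta>0$, $$\Pr\left(\frac{1}{2}\log n - (3+\delta)\log\ln n \leqslant \chi_c\left(G\left(n,\tfrac{1}{2}\right)\right)\leqslant \frac{1}{2}\log n - \left(\frac{1}{2}-\delta\right) \log\ln n\right)\to 1\quad\text{as } n\to\infty .$$
   Context: $\log$ denotes the logarithm to base $2$ and $\ln$ the natural logarithm; $\log\ln n=\log(\ln n)$. $G\left(n,\frac12\right)$ is the binomial random graph on vertex set $[n]=\{1,\ldots,n\}$, in which every pair of distinct vertices is adjacent with probability $\frac12$, independently (equivalently, a uniformly random graph on $[n]$). A clique coloring of a graph $G=(V,E)$ is a coloring of $V$ such that no inclusion-maximal clique of $G$ is monochromatic (i.e. every monochromatic clique has a vertex of another color adjacent to all its vertices). The clique chromatic number $\chi_c(G)$ is the minimum number of colors in a clique coloring of $G$. *)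

theory Defs
  imports "HOL-Probability.Probability" "HOL-Library.Ramsey"
begin

text \<open>
  A simple graph is given by its vertex set \<open>V\<close> and its set \<open>E\<close> of edges, each edge being a
  two-element subset of \<open>V\<close>.  The predicate \<open>clique K E\<close> is the one of \<open>HOL-Library.Ramsey\<close>.
\<close>

definition maximal_clique :: "'a set \<Rightarrow> 'a set set \<Rightarrow> 'a set \<Rightarrow> bool" where
  "maximal_clique V E K \<longleftrightarrow>
     K \<subseteq> V \<and> clique K E \<and> (\<forall>K'. K' \<subseteq> V \<and> clique K' E \<and> K \<subseteq> K' \<longrightarrow> K' = K)"

definition clique_coloring :: "'a set \<Rightarrow> 'a set set \<Rightarrow> ('a \<Rightarrow> nat) \<Rightarrow> bool" where
  "clique_coloring V E c \<longleftrightarrow>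
     (\<forall>K. maximal_clique V E K \<longrightarrow> \<not> (\<forall>x\<in>K. \<forall>y\<in>K. c x = c y))"

text \<open>
  The vertex set is meant to be finite.  An isolated vertex is a monochromatic maximal clique under
  every coloring, so graphs with isolated vertices have no clique coloring at all; the infimum of
  the empty set of natural numbers gives them the value \<open>0\<close>.
\<close>

definition clique_chromatic_number :: "'a set \<Rightarrow> 'a set set \<Rightarrow> nat" where
  "clique_chromatic_number V E = Inf {card (c ` V) | c. clique_coloring V E c}"

text \<open>
  The edge set of the binomial random graph on the vertex set \<open>{1..n}\<close>: one independent
  Bernoulli trial for each two-element subset of the vertex set.
\<close>

definition binomial_random_graph :: "nat \<Rightarrow> real \<Rightarrow> nat set set pmf" where
  "binomial_random_graph n p =
     map_pmf (\<lambda>f. {e \<in> [{1..n}]\<^bsup>2\<^esup>. f e})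
       (Pi_pmf ([{1..n}]\<^bsup>2\<^esup>) False (\<lambda>_. bernoulli_pmf p))"

end

theory Submission
  imports Defs "HOL-Real_Asymp.Real_Asymp"
begin

text \<open>
  Upper bound. Take \<open>k\<close> vertices, \<open>k\<close> close to \<open>1/2 log n - 1/2 log ln n\<close>, and give each neighbourhood a
  colour of its own: a clique inside a neighbourhood is not maximal. One more colour is used for the \<open>k\<close> vertices,
  which have a common neighbour, and one for the rest \<open>R\<close>, the common non-neighbours. Since \<open>R\<close> has only about
  \<open>sqrt (n ln n)\<close> elements, the expected number of cliques in \<open>R\<close> without a common neighbour tends to \<open>0\<close>.

  Lower bound. With \<open>k\<close> colours, one vertex \<open>v i\<close> per colour leaves about \<open>n / 2\<^sup>k\<close> vertices outside all
  neighbourhoods, hence some colour class \<open>C\<close> such that every vertex has many non-neighbours in \<open>C\<close>. Choose about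
  \<open>log n\<close> disjoint parts of size about \<open>sqrt n * log n\<close> in \<open>C\<close>, some of them avoiding the neighbourhoods of the few vertices
  adjacent to nearly all of \<open>C\<close>. Then at least half of the transversals of the parts have no common neighbour outside the
  parts, and by Janson's inequality one of them is a clique; it extends inside \<open>C\<close> to a monochromatic maximal clique.
\<close>

section \<open>Averages over the subsets of a finite set\<close>

text \<open>A union bound over colourings is hopeless: there are k^n of them, while some failure
  probabilities are only exp (- sqrt n) up to logarithms in the exponent. All bad events therefore
  concern the graph alone, for arbitrary vertex sets; the colouring enters deterministically
  afterwards. A class may thus lie almost inside the neighbourhoods of some vertices, which would
  spoil most transversals; hence the parts chosen against such vertices. The 3 in the lower bound:
  the number s of parts must slightly exceed log n for a typical transversal to have no common
  neighbour, and the second moment needs parts of size t of order s 2^(s/2). So k classes with s t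
  non-neighbours each require k s t, of order (log n)^3 sqrt n, common non-neighbours out of about n
  / 2^k. The 1/2 in the upper bound: s vertices very likely have a common neighbour once n / 2^s is
  well above ln n. At 2^s = n / ln n the expected number of s-cliques in R is about (e |R| / (s
  2^(s/2)))^s, which is small when |R| is a little below sqrt (n ln n).\<close>

text \<open>
  The random graph with edge probability \<open>1/2\<close> is a uniformly random subset of the set of all pairs, so
  probabilities and expectations are averages over a power set; \<open>avg S (\<lambda>X. of_bool (Q X))\<close> is the
  probability of \<open>Q\<close>.
\<close>

definition avg :: "'a set \<Rightarrow> ('a set \<Rightarrow> real) \<Rightarrow> real" where
  "avg S f = (\<Sum>X\<in>Pow S. f X) / 2 ^ card S"

lemma avg_cong: "(\<And>X. X \<subseteq> S \<Longrightarrow> f X = g X) \<Longrightarrow> avg S f = avg S g"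
  unfolding avg_def by (intro arg_cong2[where f="(/)"] sum.cong) auto

lemma avg_mono: "(\<And>X. X \<subseteq> S \<Longrightarrow> f X \<le> g X) \<Longrightarrow> avg S f \<le> avg S g"
  unfolding avg_def by (intro divide_right_mono sum_mono) auto

lemma avg_nonneg: "(\<And>X. X \<subseteq> S \<Longrightarrow> 0 \<le> f X) \<Longrightarrow> 0 \<le> avg S f"
  unfolding avg_def by (intro divide_nonneg_pos sum_nonneg) auto

lemma avg_const [simp]: "finite S \<Longrightarrow> avg S (\<lambda>_. c) = c"
  by (simp add: avg_def card_Pow)

lemma avg_add: "avg S (\<lambda>X. f X + g X) = avg S f + avg S g"
  by (simp add: avg_def sum.distrib add_divide_distrib)

lemma avg_diff: "avg S (\<lambda>X. f X - g X) = avg S f - avg S g"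
  by (simp add: avg_def sum_subtractf diff_divide_distrib)

lemma avg_cmult: "avg S (\<lambda>X. c * f X) = c * avg S f"
  by (simp add: avg_def sum_distrib_left)

lemma avg_multc: "avg S (\<lambda>X. f X * c) = avg S f * c"
  using avg_cmult[of S c f] by (simp add: mult.commute)

lemma avg_sum: "avg S (\<lambda>X. \<Sum>i\<in>I. f i X) = (\<Sum>i\<in>I. avg S (f i))"
  by (simp add: avg_def sum.swap[of _ I] sum_divide_distrib)

lemma avg_empty [simp]: "avg {} f = f {}"
  by (simp add: avg_def)

lemma avg_insert:
  assumes "finite S" "x \<notin> S"
  shows "avg (insert x S) f = (avg S f + avg S (\<lambda>X. f (insert x X))) / 2"
proof -
  have "(\<Sum>X\<in>Pow (insert x S). f X) = (\<Sum>X\<in>Pow S. f X) + (\<Sum>X\<in>insert x ` Pow S. f X)"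
    unfolding Pow_insert using assms by (intro sum.union_disjoint) auto
  also have "(\<Sum>X\<in>insert x ` Pow S. f X) = (\<Sum>X\<in>Pow S. f (insert x X))"
    using assms by (subst sum.reindex) (auto simp: inj_on_def)
  finally show ?thesis
    using assms by (simp add: avg_def add_divide_distrib mult.commute)
qed

lemma avg_union:
  assumes "finite A" "finite B" "A \<inter> B = {}"
  shows "avg (A \<union> B) f = avg A (\<lambda>X. avg B (\<lambda>Y. f (X \<union> Y)))"
  using assms
proof (induction A arbitrary: f rule: finite_induct)
  case (insert x A)
  then show ?case by (simp add: avg_insert)
qed simp

lemma avg_restrict:
  assumes "finite S" "A \<subseteq> S"
  shows "avg S (\<lambda>X. g (X \<inter> A)) = avg A g"
proof -
  have fin: "finite A" "finite (S - A)" and S: "S = A \<union> (S - A)"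
    using assms by (auto intro: finite_subset)
  have "avg S (\<lambda>X. g (X \<inter> A)) = avg A (\<lambda>X. avg (S - A) (\<lambda>Y. g ((X \<union> Y) \<inter> A)))"
    by (subst S, subst avg_union) (use fin in auto)
  also have "\<dots> = avg A (\<lambda>X. avg (S - A) (\<lambda>Y. g X))"
    by (intro avg_cong arg_cong[where f=g]) auto
  finally show ?thesis using fin by simp
qed

lemma avg_indep:
  assumes "finite S" "A \<subseteq> S" "B \<subseteq> S" "A \<inter> B = {}"
  shows "avg S (\<lambda>X. g (X \<inter> A) * h (X \<inter> B)) = avg A g * avg B h"
proof -
  have fin: "finite A" "finite B"
    using assms by (auto intro: finite_subset)
  have "avg S (\<lambda>X. g (X \<inter> A) * h (X \<inter> B)) = avg S (\<lambda>X. (\<lambda>Z. g (Z \<inter> A) * h (Z \<inter> B)) (X \<inter> (A \<union> B)))"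
    by (intro avg_cong arg_cong2[where f="(*)"] arg_cong[where f=g] arg_cong[where f=h]) auto
  also have "\<dots> = avg (A \<union> B) (\<lambda>Z. g (Z \<inter> A) * h (Z \<inter> B))"
    by (rule avg_restrict) (use assms in auto)
  also have "\<dots> = avg A (\<lambda>X. avg B (\<lambda>Y. g ((X \<union> Y) \<inter> A) * h ((X \<union> Y) \<inter> B)))"
    using assms fin by (intro avg_union) auto
  also have "\<dots> = avg A (\<lambda>X. avg B (\<lambda>Y. g X * h Y))"
    using assms by (intro avg_cong arg_cong2[where f="(*)"] arg_cong[where f=g] arg_cong[where f=h]) auto
  finally show ?thesis by (simp add: avg_cmult avg_multc)
qed

lemma avg_blocks:
  assumes "finite S" "finite I" "\<And>i. i \<in> I \<Longrightarrow> B i \<subseteq> S" "disjoint_family_on B I"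
  shows "avg S (\<lambda>X. \<Prod>i\<in>I. f i (X \<inter> B i)) = (\<Prod>i\<in>I. avg (B i) (f i))"
  using assms(2-)
proof (induction I rule: finite_induct)
  case empty
  then show ?case using assms by simp
next
  case (insert i I)
  let ?U = "\<Union>j\<in>I. B j"
  have disj: "B i \<inter> ?U = {}"
    using insert.prems(2) insert.hyps unfolding disjoint_family_on_def by auto
  have sub: "?U \<subseteq> S" using insert.prems by auto
  have "avg S (\<lambda>X. \<Prod>i\<in>insert i I. f i (X \<inter> B i)) =
        avg S (\<lambda>X. f i (X \<inter> B i) * (\<Prod>j\<in>I. f j ((X \<inter> ?U) \<inter> B j)))"
    using insert.hyps
    by (intro avg_cong) (auto intro!: arg_cong2[where f="(*)"] prod.cong arg_cong[where f="f _"])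
  also have "\<dots> = avg (B i) (f i) * avg ?U (\<lambda>Y. \<Prod>j\<in>I. f j (Y \<inter> B j))"
    using assms(1) insert.prems sub disj by (intro avg_indep) auto
  also have "avg ?U (\<lambda>Y. \<Prod>j\<in>I. f j (Y \<inter> B j)) = avg S (\<lambda>X. \<Prod>j\<in>I. f j ((X \<inter> ?U) \<inter> B j))"
    using avg_restrict[OF assms(1) sub, of "\<lambda>Y. \<Prod>j\<in>I. f j (Y \<inter> B j)"] by simp
  also have "\<dots> = avg S (\<lambda>X. \<Prod>j\<in>I. f j (X \<inter> B j))"
    by (intro avg_cong) (auto intro!: prod.cong arg_cong[where f="f _"])
  also have "\<dots> = (\<Prod>j\<in>I. avg (B j) (f j))"
    using insert.prems by (intro insert.IH) (auto simp: disjoint_family_on_def)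
  finally show ?case using insert.hyps by simp
qed

text \<open>Each element of \<open>T\<close> contributes a factor \<open>(1 + x) / 2\<close>
  independently: this is the generating function of a binomial variable.\<close>

lemma avg_power_card:
  assumes "finite S" "T \<subseteq> S"
  shows "avg S (\<lambda>X. x ^ card (X \<inter> T)) = ((1 + x) / 2) ^ card T"
proof -
  have "finite T" using assms finite_subset by auto
  then have "avg T (\<lambda>X. x ^ card X) = ((1 + x) / 2) ^ card T"
  proof (induction T rule: finite_induct)
    case (insert y T)
    have "avg T (\<lambda>X. x ^ card (insert y X)) = avg T (\<lambda>X. x * x ^ card X)"
      using insert.hyps by (intro avg_cong, subst card_insert_disjoint) (auto intro: finite_subset)
    then show ?case using insert by (simp add: avg_insert avg_cmult field_simps)
  qed simp
  then show ?thesis using avg_restrict[OF assms, of "\<lambda>X. x ^ card X"] by simp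
qed

lemma avg_of_bool_eq:
  assumes "finite S" "A \<subseteq> S" "R \<subseteq> A"
  shows "avg S (\<lambda>X. of_bool (X \<inter> A = R)) = (1 / 2) ^ card A"
proof -
  have finA: "finite A" using assms finite_subset by auto
  have "avg S (\<lambda>X. of_bool (X \<inter> A = R)) = avg A (\<lambda>X. of_bool (X = R))"
    by (rule avg_restrict[OF assms(1,2), of "\<lambda>X. of_bool (X = R)"])
  also have "\<dots> = (1 / 2) ^ card A"
    using assms(3) finA
    by (simp add: avg_def of_bool_def sum.If_cases power_one_over flip: sum.delta)
  finally show ?thesis .
qed

lemma avg_superset:
  assumes "finite S" "A \<subseteq> S"
  shows "avg S (\<lambda>X. of_bool (A \<subseteq> X)) = (1 / 2) ^ card A"
proof -
  have "avg S (\<lambda>X. of_bool (A \<subseteq> X)) = avg S (\<lambda>X. of_bool (X \<inter> A = A))"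
    by (intro avg_cong arg_cong[where f=of_bool]) blast
  then show ?thesis using avg_of_bool_eq[OF assms order_refl] by simp
qed

section \<open>The inequalities of Harris and Janson\<close>

text \<open>Induction on \<open>S\<close>: both halves of the power set, without and with
  \<open>x\<close>, satisfy the claim, and what remains is the two-point inequality. The product of
  the two differences of averages is nonnegative because both functions decrease.\<close>

lemma harris:
  assumes "finite S"
    and "\<forall>X Y. X \<subseteq> Y \<longrightarrow> Y \<subseteq> S \<longrightarrow> f Y \<le> f X"
    and "\<forall>X Y. X \<subseteq> Y \<longrightarrow> Y \<subseteq> S \<longrightarrow> g Y \<le> g X"
  shows "avg S f * avg S g \<le> avg S (\<lambda>X. f X * g X)"
  using assms
proof (induction S arbitrary: f g rule: finite_induct)
  case empty
  show ?case unfolding avg_empty by (rule order_refl)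
next
  case (insert x S)
  let ?f = "\<lambda>X. f (insert x X)" and ?g = "\<lambda>X. g (insert x X)"
  have anti: "h (insert x X) \<le> h X" "X \<subseteq> Y \<Longrightarrow> Y \<subseteq> S \<Longrightarrow> h Y \<le> h X"
      "X \<subseteq> Y \<Longrightarrow> Y \<subseteq> S \<Longrightarrow> h (insert x Y) \<le> h (insert x X)"
    if h: "\<forall>X Y. X \<subseteq> Y \<longrightarrow> Y \<subseteq> insert x S \<longrightarrow> h Y \<le> h X" and "X \<subseteq> S"
    for h :: "'a set \<Rightarrow> real" and X Y
    by (rule h[rule_format]; use that(2) in blast)+
  have "avg S ?f \<le> avg S f"
    by (rule avg_mono) (rule anti(1)[OF insert.prems(1)])
  moreover have "avg S ?g \<le> avg S g"
    by (rule avg_mono) (rule anti(1)[OF insert.prems(2)])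
  ultimately have "0 \<le> (avg S f - avg S ?f) * (avg S g - avg S ?g)"
    by simp
  moreover have "avg S f * avg S g \<le> avg S (\<lambda>X. f X * g X)"
    by (rule insert.IH) (use anti(2) insert.prems in \<open>meson subset_trans\<close>)+
  moreover have "avg S ?f * avg S ?g \<le> avg S (\<lambda>X. ?f X * ?g X)"
    by (rule insert.IH) (use anti(3) insert.prems in \<open>meson subset_trans\<close>)+
  ultimately show ?case
    unfolding avg_insert[OF insert.hyps] by (simp add: algebra_simps)
qed

lemma harris_opposite:
  assumes "finite S"
    and "\<And>X Y. X \<subseteq> Y \<Longrightarrow> Y \<subseteq> S \<Longrightarrow> f X \<le> f Y"
    and "\<And>X Y. X \<subseteq> Y \<Longrightarrow> Y \<subseteq> S \<Longrightarrow> g Y \<le> g X"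
  shows "avg S (\<lambda>X. f X * g X) \<le> avg S f * avg S g"
proof -
  have neg: "avg S (\<lambda>X. - h X) = - avg S h" for h
    using avg_cmult[of S "-1" h] by simp
  have "avg S (\<lambda>X. - f X) * avg S g \<le> avg S (\<lambda>X. - f X * g X)"
  proof (rule harris[OF assms(1)]; intro allI impI)
    show "- f Y \<le> - f X" if "X \<subseteq> Y" "Y \<subseteq> S" for X Y
      using assms(2)[OF that] by linarith
    show "g Y \<le> g X" if "X \<subseteq> Y" "Y \<subseteq> S" for X Y
      using assms(3)[OF that] .
  qed
  then show ?thesis by (simp add: neg)
qed

text \<open>
  The weight \<open>q\<close> replaces the passage to a random subfamily in the usual proof of the extended Janson
  inequality: the product bounds the indicator of ``no \<open>e i\<close> is contained in \<open>X\<close>'' from above for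
  every \<open>q\<close>, and \<open>q = \<mu> / \<Delta>\<close> is optimal.
\<close>

lemma janson_weighted:
  fixes e :: "'i \<Rightarrow> 'a set" and q :: real
  assumes S: "finite S" and F: "finite F" and eS: "\<And>i. i \<in> F \<Longrightarrow> e i \<subseteq> S"
    and q: "0 \<le> q" "q \<le> 1"
  shows "avg S (\<lambda>X. \<Prod>i\<in>F. 1 - q * of_bool (e i \<subseteq> X))
    \<le> exp (- q * (\<Sum>i\<in>F. (1/2) ^ card (e i))
          + q\<^sup>2 / 2 * (\<Sum>i\<in>F. \<Sum>j\<in>{j\<in>F. e i \<inter> e j \<noteq> {}}. (1/2) ^ card (e i \<union> e j)))"
  using F eS
proof (induction F rule: finite_induct)
  case empty
  then show ?case using S by simp
next
  case (insert i F)
  define I where "I j X = (of_bool (e j \<subseteq> X) :: real)" for j X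
  define W where "W G X = (\<Prod>j\<in>G. 1 - q * I j X)" for G X
  define N where "N = {j\<in>F. e i \<inter> e j \<noteq> {}}"
  define D where "D = {j\<in>F. e i \<inter> e j = {}}"
  define p where "p = (1/2::real) ^ card (e i)"
  define P where "P = (\<Sum>j\<in>N. (1/2::real) ^ card (e i \<union> e j))"
  define \<Delta> where "\<Delta> G = (\<Sum>i\<in>G. \<Sum>j\<in>{j\<in>G. e i \<inter> e j \<noteq> {}}. (1/2::real) ^ card (e i \<union> e j))" for G
  have fin: "finite N" "finite D" "N \<inter> D = {}" "F = N \<union> D"
    using insert.hyps unfolding N_def D_def by auto
  have factor: "0 \<le> 1 - q * I j X" "1 - q * I j X \<le> 1" for j X
    using q unfolding I_def by auto
  have W01: "0 \<le> W G X" "W G X \<le> 1" for G X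
    unfolding W_def by (auto intro!: prod_nonneg prod_le_1 factor)
  have W_anti: "W G Y \<le> W G X" if "X \<subseteq> Y" for G X Y
    unfolding W_def using that q factor
    by (intro prod_mono) (auto simp: I_def intro!: mult_left_mono)
  have WF: "W F X = W D X * W N X" for X
    unfolding W_def using fin by (simp add: prod.union_disjoint mult.commute)
  have bern: "1 - q * (\<Sum>j\<in>N. I j X) \<le> W N X" for X
  proof -
    have "1 - (\<Sum>j\<in>N. q * I j X) \<le> (\<Prod>j\<in>N. 1 - q * I j X)"
      by (rule Weierstrass_prod_ineq) (use q in \<open>auto simp: I_def\<close>)
    then show ?thesis by (simp add: W_def sum_distrib_left)
  qed
  have ei: "e i \<subseteq> S" and ej: "j \<in> F \<Longrightarrow> e j \<subseteq> S" for j using insert.prems by auto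
  have indep: "avg S (\<lambda>X. I i X * W D X) = p * avg S (W D)"
  proof -
    let ?B = "\<Union>j\<in>D. e j"
    have B: "?B \<subseteq> S" "e i \<inter> ?B = {}" using ej fin unfolding D_def by auto
    have I: "I i X = of_bool (e i \<subseteq> X \<inter> e i)" for X by (auto simp: I_def)
    have WD: "W D X = W D (X \<inter> ?B)" for X
      unfolding W_def I_def
      by (intro prod.cong arg_cong2[where f="(-)"] arg_cong2[where f="(*)"]
          arg_cong[where f=of_bool]) auto
    have "avg S (\<lambda>X. I i X * W D X) = avg S (\<lambda>X. of_bool (e i \<subseteq> X \<inter> e i) * W D (X \<inter> ?B))"
      by (intro avg_cong arg_cong2[where f="(*)"] I WD)
    also have "\<dots> = avg (e i) (\<lambda>X. of_bool (e i \<subseteq> X)) * avg ?B (W D)"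
      by (rule avg_indep[OF S ei B])
    also have "avg (e i) (\<lambda>X. of_bool (e i \<subseteq> X)) = p"
      using avg_superset[of "e i" "e i"] finite_subset[OF ei S] by (simp add: p_def)
    also have "avg ?B (W D) = avg S (W D)"
      using avg_restrict[OF S B(1), of "W D"] by (simp flip: WD)
    finally show ?thesis .
  qed
  have pair: "avg S (\<lambda>X. I i X * I j X * W D X) \<le> (1/2) ^ card (e i \<union> e j) * avg S (W D)"
    if "j \<in> N" for j
  proof -
    have eq: "I i X * I j X = of_bool (e i \<union> e j \<subseteq> X)" for X by (auto simp: I_def)
    have "avg S (\<lambda>X. of_bool (e i \<union> e j \<subseteq> X) * W D X)
        \<le> avg S (\<lambda>X. of_bool (e i \<union> e j \<subseteq> X)) * avg S (W D)"
      by (rule harris_opposite[OF S]) (auto intro: W_anti)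
    also have "avg S (\<lambda>X. of_bool (e i \<union> e j \<subseteq> X)) = (1/2) ^ card (e i \<union> e j)"
      by (rule avg_superset[OF S]) (use ei ej that N_def in auto)
    finally show ?thesis by (simp add: eq)
  qed
  have DF: "avg S (W F) \<le> avg S (W D)"
    using WF W01 by (intro avg_mono) (auto intro: mult_left_le)
  have F0: "0 \<le> avg S (W F)" by (intro avg_nonneg W01)
  have P0: "0 \<le> P" unfolding P_def by (intro sum_nonneg) auto
  \<comment> \<open>This bounds from below the drop of the average when \<open>i\<close> is added.
    The factors with index in \<open>D\<close> are independent of \<open>I i\<close>, those in
    \<open>N\<close> are linearised by \<open>bern\<close>, and the resulting pair terms are
    controlled by Harris' inequality. A negative coefficient makes the claim trivial.\<close>
  have step: "(p - q * P) * avg S (W F) \<le> avg S (\<lambda>X. I i X * W F X)"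
  proof (cases "0 \<le> p - q * P")
    case True
    have "(p - q * P) * avg S (W F) \<le> (p - q * P) * avg S (W D)"
      using True DF by (rule mult_left_mono[rotated])
    also have "\<dots> = p * avg S (W D) - q * (\<Sum>j\<in>N. (1/2) ^ card (e i \<union> e j) * avg S (W D))"
      by (simp add: P_def algebra_simps sum_distrib_left sum_distrib_right)
    also have "\<dots> \<le> avg S (\<lambda>X. I i X * W D X) - q * (\<Sum>j\<in>N. avg S (\<lambda>X. I i X * I j X * W D X))"
      unfolding indep using q pair by (intro diff_left_mono mult_left_mono sum_mono) auto
    also have "\<dots> = avg S (\<lambda>X. I i X * W D X - q * (\<Sum>j\<in>N. I i X * I j X * W D X))"
      by (simp add: avg_diff avg_cmult avg_sum)
    also have "\<dots> = avg S (\<lambda>X. I i X * W D X * (1 - q * (\<Sum>j\<in>N. I j X)))"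
      by (intro avg_cong) (simp add: algebra_simps sum_distrib_left)
    also have "\<dots> \<le> avg S (\<lambda>X. I i X * W D X * W N X)"
      by (intro avg_mono mult_left_mono bern mult_nonneg_nonneg W01) (simp add: I_def)
    finally show ?thesis by (simp add: WF mult.assoc)
  next
    case False
    then have "(p - q * P) * avg S (W F) \<le> 0"
      using F0 by (intro mult_nonpos_nonneg) auto
    also have "0 \<le> avg S (\<lambda>X. I i X * W F X)"
      by (intro avg_nonneg mult_nonneg_nonneg W01) (simp add: I_def)
    finally show ?thesis .
  qed
  have "avg S (W (insert i F)) = avg S (W F) - q * avg S (\<lambda>X. I i X * W F X)"
  proof -
    have "W (insert i F) X = W F X - q * (I i X * W F X)" for X
      using insert.hyps by (simp add: W_def algebra_simps)
    then have "avg S (W (insert i F)) = avg S (\<lambda>X. W F X - q * (I i X * W F X))"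
      by (intro avg_cong)
    then show ?thesis by (simp add: avg_diff avg_cmult)
  qed
  also have "\<dots> \<le> avg S (W F) - q * ((p - q * P) * avg S (W F))"
    using step q by (intro diff_left_mono mult_left_mono)
  also have "\<dots> = avg S (W F) * (1 + (- q * p + q\<^sup>2 * P))"
    by (simp add: algebra_simps power2_eq_square)
  also have "\<dots> \<le> avg S (W F) * exp (- q * p + q\<^sup>2 * P)"
    using F0 exp_ge_add_one_self by (intro mult_left_mono) auto
  also have "\<dots> \<le> exp (- q * (\<Sum>i\<in>F. (1/2) ^ card (e i)) + q\<^sup>2 / 2 * \<Delta> F) * exp (- q * p + q\<^sup>2 * P)"
    using insert.IH insert.prems unfolding W_def I_def \<Delta>_def by (intro mult_right_mono) auto
  also have "\<dots> = exp (- q * (\<Sum>i\<in>insert i F. (1/2) ^ card (e i)) + q\<^sup>2 / 2 * (\<Delta> F + 2 * P))"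
    using insert.hyps by (simp add: p_def algebra_simps flip: exp_add)
  \<comment> \<open>The double sum runs over ordered pairs: each \<open>j\<close> in
    \<open>N\<close> occurs in the row of \<open>i\<close> and again in its own row, hence
    \<open>2 * P\<close>. The diagonal term of \<open>i\<close> is dropped.\<close>
  also have "\<dots> \<le> exp (- q * (\<Sum>i\<in>insert i F. (1/2) ^ card (e i)) + q\<^sup>2 / 2 * \<Delta> (insert i F))"
  proof -
    have "P \<le> (\<Sum>j\<in>{j\<in>insert i F. e i \<inter> e j \<noteq> {}}. (1/2) ^ card (e i \<union> e j))"
      unfolding P_def N_def using insert.hyps by (intro sum_mono2) auto
    moreover have "(\<Sum>j\<in>{j\<in>F. e k \<inter> e j \<noteq> {}}. (1/2) ^ card (e k \<union> e j))
        + (if e k \<inter> e i \<noteq> {} then (1/2::real) ^ card (e k \<union> e i) else 0)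
        = (\<Sum>j\<in>{j\<in>insert i F. e k \<inter> e j \<noteq> {}}. (1/2) ^ card (e k \<union> e j))" for k
    proof -
      have "{j\<in>insert i F. e k \<inter> e j \<noteq> {}} =
        (if e k \<inter> e i \<noteq> {} then insert i {j\<in>F. e k \<inter> e j \<noteq> {}} else {j\<in>F. e k \<inter> e j \<noteq> {}})"
        by auto
      then show ?thesis using insert.hyps by simp
    qed
    ultimately have "\<Delta> (insert i F) \<ge> P + (\<Sum>k\<in>F. (\<Sum>j\<in>{j\<in>F. e k \<inter> e j \<noteq> {}}. (1/2) ^ card (e k \<union> e j))
        + (if e k \<inter> e i \<noteq> {} then (1/2) ^ card (e k \<union> e i) else 0))"
      unfolding \<Delta>_def using insert.hyps by simp
    also have "(\<Sum>k\<in>F. (\<Sum>j\<in>{j\<in>F. e k \<inter> e j \<noteq> {}}. (1/2) ^ card (e k \<union> e j))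
        + (if e k \<inter> e i \<noteq> {} then (1/2) ^ card (e k \<union> e i) else 0)) = \<Delta> F + P"
      unfolding sum.distrib \<Delta>_def P_def N_def using insert.hyps
      by (simp add: sum.If_cases Int_def Int_commute Un_commute conj_commute)
    finally have "\<Delta> F + 2 * P \<le> \<Delta> (insert i F)" by simp
    then show ?thesis by (simp add: mult_left_mono)
  qed
  finally show ?case unfolding W_def I_def \<Delta>_def .
qed

text \<open>The exponent of the weighted bound is monotone in both sums, so a lower estimate
  \<open>\<mu>\<close> and an upper estimate \<open>\<Delta>\<close> suffice;
  \<open>\<mu> \<le> \<Delta>\<close> makes the weight \<open>q\<close> at most 1. The double sum
  includes the pairs \<open>i = j\<close> with nonempty \<open>e i\<close>.\<close>

lemma janson:
  fixes e :: "'i \<Rightarrow> 'a set" and \<mu> \<Delta> :: real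
  assumes S: "finite S" and F: "finite F" and eS: "\<And>i. i \<in> F \<Longrightarrow> e i \<subseteq> S"
    and mu: "(\<Sum>i\<in>F. (1/2) ^ card (e i)) \<ge> \<mu>"
    and Delta: "(\<Sum>i\<in>F. \<Sum>j\<in>{j\<in>F. e i \<inter> e j \<noteq> {}}. (1/2) ^ card (e i \<union> e j)) \<le> \<Delta>"
    and "0 \<le> \<mu>" "\<mu> \<le> \<Delta>" "0 < \<Delta>"
  shows "avg S (\<lambda>X. of_bool (\<forall>i\<in>F. \<not> e i \<subseteq> X)) \<le> exp (- \<mu>\<^sup>2 / (2 * \<Delta>))"
proof -
  define q where "q = \<mu> / \<Delta>"
  have q: "0 \<le> q" "q \<le> 1" using assms by (auto simp: q_def)
  have "avg S (\<lambda>X. of_bool (\<forall>i\<in>F. \<not> e i \<subseteq> X)) \<le> avg S (\<lambda>X. \<Prod>i\<in>F. 1 - q * of_bool (e i \<subseteq> X))"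
    using q by (intro avg_mono) (auto intro!: prod_nonneg)
  also have "\<dots> \<le> exp (- q * (\<Sum>i\<in>F. (1/2) ^ card (e i))
          + q\<^sup>2 / 2 * (\<Sum>i\<in>F. \<Sum>j\<in>{j\<in>F. e i \<inter> e j \<noteq> {}}. (1/2) ^ card (e i \<union> e j)))"
    by (rule janson_weighted) (use assms q in auto)
  also have "\<dots> \<le> exp (- (q * \<mu>) + q\<^sup>2 / 2 * \<Delta>)"
    unfolding mult_minus_left using mu Delta q by (intro exp_le_cancel_iff[THEN iffD2] add_mono le_imp_neg_le mult_left_mono) auto
  also have "- (q * \<mu>) + q\<^sup>2 / 2 * \<Delta> = - \<mu>\<^sup>2 / (2 * \<Delta>)"
    using \<open>0 < \<Delta>\<close> by (simp add: q_def power2_eq_square field_simps)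
  finally show ?thesis .
qed

section \<open>Cliques among the transversals of disjoint sets\<close>

lemma avg_union_bound:
  assumes "finite I"
  shows "avg S (\<lambda>X. of_bool (\<exists>i\<in>I. Q i X)) \<le> (\<Sum>i\<in>I. avg S (\<lambda>X. of_bool (Q i X)))"
  unfolding avg_sum[symmetric]
proof (rule avg_mono)
  fix X
  show "(of_bool (\<exists>i\<in>I. Q i X) :: real) \<le> (\<Sum>i\<in>I. of_bool (Q i X))"
  proof (cases "\<exists>i\<in>I. Q i X")
    case True
    then obtain i where "i \<in> I" "Q i X" by blast
    then show ?thesis
      using member_le_sum[of i I "\<lambda>i. of_bool (Q i X) :: real"] assms by simp
  qed (simp add: sum_nonneg)
qed

lemma avg_union_bound_card:
  fixes N b :: real
  assumes "finite I" "\<And>i. i \<in> I \<Longrightarrow> avg S (\<lambda>X. of_bool (Q i X)) \<le> b" "real (card I) \<le> N" "0 \<le> b"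
  shows "avg S (\<lambda>X. of_bool (\<exists>i\<in>I. Q i X)) \<le> N * b"
proof -
  have "avg S (\<lambda>X. of_bool (\<exists>i\<in>I. Q i X)) \<le> (\<Sum>i\<in>I. avg S (\<lambda>X. of_bool (Q i X)))"
    by (rule avg_union_bound[OF assms(1)])
  also have "\<dots> \<le> real (card I) * b"
    by (rule sum_bounded_above) (rule assms(2))
  also have "\<dots> \<le> N * b"
    using assms by (intro mult_right_mono) auto
  finally show ?thesis .
qed

lemma sum_power_card_Pow:
  assumes "finite S"
  shows "(\<Sum>X\<in>Pow S. (x::real) ^ card X) = (1 + x) ^ card S"
proof -
  have "(\<Sum>X\<in>Pow S. x ^ card X) / 2 ^ card S = avg S (\<lambda>X. x ^ card (X \<inter> S))"
    unfolding avg_def by (intro arg_cong2[where f="(/)"] sum.cong) (auto simp: Int_absorb2)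
  also have "\<dots> = (1 + x) ^ card S / 2 ^ card S"
    using avg_power_card[OF assms order_refl] by (simp add: power_divide)
  finally show ?thesis by simp
qed

text \<open>Pairs of transversals agreeing in \<open>i\<close> parts gain a weight
  \<open>2 ^ (i choose 2)\<close> but are rarer by a factor \<open>t ^ i\<close>. The bound leaves
  \<open>s ^ i\<close> for the sum over agreement sets and \<open>2 ^ (s + 3)\<close> for the
  exponent in Janson's inequality. The comparison of the powers of two is an equality at
  \<open>i = 2\<close>, which explains the exponent \<open>h + 2\<close>.\<close>

lemma transversal_pair_weight:
  fixes s h t i :: nat
  assumes "s = 2 * h" "s * 2 ^ (h + 2) \<le> t" "2 \<le> i" "i \<le> s"
  shows "s ^ i * 2 ^ (i choose 2) * 2 ^ (s + 3) \<le> t ^ i"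
proof -
  obtain k d where kd: "i = k + 2" "s = k + 2 + d"
    using assms(3,4) by (metis add.commute le_Suc_ex)
  have "2 * ((i choose 2) + (s + 3)) = (k + 2) * (k + 1) + 2 * (k + d + 5)"
    by (simp add: kd choose_two)
  also have "\<dots> \<le> (s + 4) * i"
    by (simp add: kd algebra_simps)
  also have "\<dots> = 2 * ((h + 2) * i)"
    by (simp add: assms(1) algebra_simps)
  finally have *: "(i choose 2) + (s + 3) \<le> (h + 2) * i" by simp
  have "s ^ i * 2 ^ (i choose 2) * 2 ^ (s + 3) = s ^ i * 2 ^ ((i choose 2) + (s + 3))"
    by (simp add: power_add)
  also have "\<dots> \<le> s ^ i * 2 ^ ((h + 2) * i)"
    using * by (intro mult_left_mono power_increasing) auto
  also have "\<dots> = (s * 2 ^ (h + 2)) ^ i"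
    by (simp only: power_mult_distrib power_mult)
  also have "\<dots> \<le> t ^ i" using assms by (intro power_mono) auto
  finally show ?thesis .
qed

text \<open>
  Transversals of \<open>s\<close> disjoint sets of size \<open>t \<ge> 4 s 2\<^sup>s\<^sup>/\<^sup>2\<close> contain cliques with failure probability
  doubly exponentially small in \<open>s\<close>, which survives a union bound over all choices of the sets.
\<close>

locale parts =
  fixes s t :: nat and A :: "nat \<Rightarrow> 'a set"
  assumes disj: "disjoint_family_on A {..<s}"
    and cardA: "\<And>j. j < s \<Longrightarrow> card (A j) = t"
    and finA: "\<And>j. j < s \<Longrightarrow> finite (A j)"
begin

definition transversals :: "(nat \<Rightarrow> 'a) set" where
  "transversals = PiE {..<s} A"

definition edges_of :: "(nat \<Rightarrow> 'a) \<Rightarrow> 'a set set" where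
  "edges_of f = [f ` {..<s}]\<^bsup>2\<^esup>"

lemma finite_transversals: "finite transversals"
  unfolding transversals_def by (intro finite_PiE finA) auto

lemma card_transversals: "card transversals = t ^ s"
  unfolding transversals_def by (simp add: card_PiE cardA)

lemma transversal_mem: "f \<in> transversals \<Longrightarrow> j < s \<Longrightarrow> f j \<in> A j"
  unfolding transversals_def by auto

lemma transversal_eq:
  assumes "f \<in> transversals" "g \<in> transversals" "i < s" "j < s" "f i = g j"
  shows "i = j"
proof (rule ccontr)
  assume "i \<noteq> j"
  then have "A i \<inter> A j = {}"
    using disj assms by (auto simp: disjoint_family_on_def)
  then show False
    using transversal_mem[OF assms(1,3)] transversal_mem[OF assms(2,4)] assms(5) by auto
qed

lemma inj_transversal: "f \<in> transversals \<Longrightarrow> inj_on f {..<s}"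
  using transversal_eq[of f f] by (auto simp: inj_on_def)

lemma card_edges_of: "f \<in> transversals \<Longrightarrow> card (edges_of f) = s choose 2"
  unfolding edges_of_def by (simp add: card_image inj_transversal)

lemma edges_of_subset: "f \<in> transversals \<Longrightarrow> edges_of f \<subseteq> [\<Union>j<s. A j]\<^bsup>2\<^esup>"
  unfolding edges_of_def using transversal_mem by (intro nsets_mono) auto

definition agree :: "(nat \<Rightarrow> 'a) \<Rightarrow> (nat \<Rightarrow> 'a) \<Rightarrow> nat set" where
  "agree f g = {j. j < s \<and> f j = g j}"

lemma edges_of_Int:
  assumes "f \<in> transversals" "g \<in> transversals"
  shows "edges_of f \<inter> edges_of g = [f ` agree f g]\<^bsup>2\<^esup>"
proof -
  have "f ` {..<s} \<inter> g ` {..<s} = f ` agree f g"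
    using transversal_eq[OF assms] unfolding agree_def by (force simp: image_iff)
  moreover have "[B]\<^bsup>2\<^esup> \<inter> [C]\<^bsup>2\<^esup> = [B \<inter> C]\<^bsup>2\<^esup>" for B C :: "'a set"
    by (auto simp: nsets_def)
  ultimately show ?thesis unfolding edges_of_def by metis
qed

lemma card_edges_of_Int:
  assumes "f \<in> transversals" "g \<in> transversals"
  shows "card (edges_of f \<inter> edges_of g) = card (agree f g) choose 2"
proof -
  have "inj_on f (agree f g)"
    using inj_transversal[OF assms(1)] by (rule inj_on_subset) (auto simp: agree_def)
  then show ?thesis by (simp add: edges_of_Int[OF assms] card_image)
qed

lemma finite_edges_of: "finite (edges_of f)"
  unfolding edges_of_def by (intro finite_imp_finite_nsets) auto

lemma weight_edges_of_Un:
  assumes "f \<in> transversals" "g \<in> transversals"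
  shows "(1/2::real) ^ card (edges_of f \<union> edges_of g)
      = (1/2) ^ (2 * (s choose 2)) * 2 ^ (card (agree f g) choose 2)"
proof -
  have "card (edges_of f \<union> edges_of g) + (card (agree f g) choose 2) = 2 * (s choose 2)"
    using card_Un_Int[OF finite_edges_of finite_edges_of, of f g] card_edges_of assms
    by (simp add: card_edges_of_Int)
  then have "(1/2::real) ^ (2 * (s choose 2))
      = (1/2) ^ card (edges_of f \<union> edges_of g) * (1/2) ^ (card (agree f g) choose 2)"
    by (simp flip: power_add)
  then show ?thesis by (simp add: power_divide)
qed

lemma card_agree_superset:
  assumes "f \<in> transversals" "I \<subseteq> {..<s}"
  shows "card {g\<in>transversals. agree f g = I} \<le> t ^ (s - card I)"
proof -
  let ?G = "PiE {..<s} (\<lambda>j. if j \<in> I then {f j} else A j)"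
  have "card {g\<in>transversals. agree f g = I} \<le> card ?G"
  proof (rule card_mono)
    show "finite ?G" using finA by (intro finite_PiE) auto
    show "{g\<in>transversals. agree f g = I} \<subseteq> ?G"
      unfolding transversals_def agree_def PiE_def Pi_def by auto
  qed
  also have "card ?G = (\<Prod>j<s. if j \<in> I then 1 else t)"
    using cardA by (auto simp: card_PiE intro!: prod.cong)
  also have "\<dots> = t ^ card ({..<s} - I)"
    by (simp add: prod.If_cases Diff_eq)
  also have "card ({..<s} - I) = s - card I"
    using assms(2) finite_subset[OF assms(2)] by (simp add: card_Diff_subset)
  finally show ?thesis .
qed

text \<open>A common edge forces agreement in at least two parts. Grouped by the agreement set
  \<open>I\<close>, the contributions are bounded by multiples of \<open>(1 / s) ^ card I\<close>,
  whose sum over all \<open>I\<close> is at most \<open>(1 + 1 / s) ^ s \<le> 3\<close>.\<close>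

lemma pair_sum_bound:
  assumes "f \<in> transversals" and s: "s = 2 * h" "0 < s" and t: "s * 2 ^ (h + 2) \<le> t"
  shows "(\<Sum>g\<in>{g\<in>transversals. edges_of f \<inter> edges_of g \<noteq> {}}. (1/2::real) ^ card (edges_of f \<union> edges_of g))
    \<le> (1/2) ^ (2 * (s choose 2)) * t ^ s * (3 / 2 ^ (s + 3))"
proof -
  define c where "c = (1/2::real) ^ (2 * (s choose 2))"
  have c: "c > 0" by (simp add: c_def)
  have t0: "t > 0" using s t by (cases t) auto
  define \<I> where "\<I> = {I. I \<subseteq> {..<s} \<and> 2 \<le> card I}"
  have fin\<I>: "finite \<I>" unfolding \<I>_def by (rule finite_subset[of _ "Pow {..<s}"]) auto
  have agr: "agree f g \<in> \<I>" if "g \<in> transversals" "edges_of f \<inter> edges_of g \<noteq> {}" for g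
  proof -
    have "card (agree f g) choose 2 \<noteq> 0"
      using that card_edges_of_Int[OF assms(1) that(1)] finite_edges_of[of f]
      by (metis card_eq_0_iff finite_Int)
    then show ?thesis by (auto simp: \<I>_def agree_def)
  qed
  have "(\<Sum>g\<in>{g\<in>transversals. edges_of f \<inter> edges_of g \<noteq> {}}. (1/2::real) ^ card (edges_of f \<union> edges_of g))
      = (\<Sum>g\<in>{g\<in>transversals. edges_of f \<inter> edges_of g \<noteq> {}}. c * 2 ^ (card (agree f g) choose 2))"
    using weight_edges_of_Un[OF assms(1)] by (intro sum.cong) (auto simp: c_def)
  also have "\<dots> \<le> (\<Sum>g\<in>{g\<in>transversals. agree f g \<in> \<I>}. c * 2 ^ (card (agree f g) choose 2))"
    using finite_transversals agr c by (intro sum_mono2) auto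
  also have "\<dots> = (\<Sum>I\<in>\<I>. \<Sum>g\<in>{g\<in>{g\<in>transversals. agree f g \<in> \<I>}. agree f g = I}. c * 2 ^ (card (agree f g) choose 2))"
    using finite_transversals fin\<I> by (intro sum.group[symmetric]) auto
  also have "\<dots> \<le> (\<Sum>I\<in>\<I>. c * t ^ s / 2 ^ (s + 3) * (1 / s) ^ card I)"
  proof (rule sum_mono)
    fix I assume I: "I \<in> \<I>"
    define i where "i = card I"
    have i: "2 \<le> i" "i \<le> s"
      using I card_mono[of "{..<s}" I] by (auto simp: \<I>_def i_def)
    have "(\<Sum>g\<in>{g\<in>{g\<in>transversals. agree f g \<in> \<I>}. agree f g = I}. c * 2 ^ (card (agree f g) choose 2))
        = (\<Sum>g\<in>{g\<in>transversals. agree f g = I}. c * 2 ^ (i choose 2))"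
      using I by (intro sum.cong) (auto simp: i_def)
    also have "\<dots> \<le> t ^ (s - i) * (c * 2 ^ (i choose 2))"
      using card_agree_superset[OF assms(1), of I] I c
      by (auto simp: i_def \<I>_def intro!: mult_right_mono simp flip: of_nat_power)
    also have "\<dots> \<le> t ^ (s - i) * (c * (t ^ i / (s ^ i * 2 ^ (s + 3))))"
    proof -
      have "real (s ^ i * 2 ^ (i choose 2) * 2 ^ (s + 3)) \<le> real (t ^ i)"
        using transversal_pair_weight[OF s(1) t i] by (simp only: of_nat_le_iff)
      then have "2 ^ (i choose 2) \<le> t ^ i / (real s ^ i * 2 ^ (s + 3))"
        using s(2) by (simp add: field_simps)
      then show ?thesis using c by (intro mult_left_mono) auto
    qed
    also have "\<dots> = c * t ^ s / 2 ^ (s + 3) * (1 / s) ^ i"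
      using i by (simp add: power_divide field_simps flip: power_add)
    finally show "(\<Sum>g\<in>{g\<in>{g\<in>transversals. agree f g \<in> \<I>}. agree f g = I}. c * 2 ^ (card (agree f g) choose 2))
      \<le> c * t ^ s / 2 ^ (s + 3) * (1 / s) ^ card I" by (simp add: i_def)
  qed
  also have "\<dots> = c * t ^ s / 2 ^ (s + 3) * (\<Sum>I\<in>\<I>. (1 / s) ^ card I)"
    by (simp add: sum_distrib_left)
  also have "\<dots> \<le> c * t ^ s / 2 ^ (s + 3) * 3"
  proof (intro mult_left_mono)
    have "(\<Sum>I\<in>\<I>. (1 / s) ^ card I) \<le> (\<Sum>I\<in>Pow {..<s}. (1 / real s) ^ card I)"
      by (intro sum_mono2) (auto simp: \<I>_def)
    also have "\<dots> = (1 + 1 / real s) ^ s" by (simp add: sum_power_card_Pow)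
    also have "\<dots> \<le> exp 1"
      using exp_ge_one_plus_x_over_n_power_n[of s 1] s(2) by simp
    also have "\<dots> \<le> 3" by (rule exp_le)
    finally show "(\<Sum>I\<in>\<I>. (1 / s) ^ card I) \<le> 3" .
  qed (use c in auto)
  finally show ?thesis by (simp add: c_def)
qed

text \<open>Passing to half of the transversals costs the mean only a factor 2, while
  \<open>\<Delta>\<close> is estimated by all pairs of transversals. With
  \<open>\<mu> = t ^ s * c / 2\<close> and
  \<open>\<Delta> = 3 * (t ^ s * c)\<^sup>2 / 2 ^ (s + 3)\<close> Janson's exponent is exactly
  \<open>2 ^ s / 3\<close>.\<close>

lemma transversal_clique:
  assumes s: "s = 2 * h" "0 < s" and t: "s * 2 ^ (h + 2) \<le> t"
    and F: "F \<subseteq> transversals" "t ^ s \<le> 2 * card F"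
  shows "avg ([\<Union>j<s. A j]\<^bsup>2\<^esup>) (\<lambda>X. of_bool (\<forall>f\<in>F. \<not> edges_of f \<subseteq> X)) \<le> exp (- (2 ^ s / 3))"
proof -
  define c where "c = (1/2::real) ^ (s choose 2)"
  define \<mu> where "\<mu> = t ^ s * c / 2"
  define \<Delta> where "\<Delta> = t ^ s * (c\<^sup>2 * t ^ s * (3 / 2 ^ (s + 3)))"
  have c: "c > 0" by (simp add: c_def)
  have t0: "t > 0" using s t by (cases t) auto
  have finF: "finite F" using F finite_transversals finite_subset by blast
  have cF: "real (t ^ s) \<le> 2 * real (card F)"
    using F(2) of_nat_le_iff[of "t ^ s" "2 * card F", where 'a=real] by (simp only: of_nat_mult of_nat_numeral)
  have "avg ([\<Union>j<s. A j]\<^bsup>2\<^esup>) (\<lambda>X. of_bool (\<forall>f\<in>F. \<not> edges_of f \<subseteq> X)) \<le> exp (- \<mu>\<^sup>2 / (2 * \<Delta>))"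
  proof (rule janson)
    show "finite ([\<Union>j<s. A j]\<^bsup>2\<^esup>)" using finA by (intro finite_imp_finite_nsets) auto
    show "finite F" by (rule finF)
    show "edges_of f \<subseteq> [\<Union>j<s. A j]\<^bsup>2\<^esup>" if "f \<in> F" for f
      using F that edges_of_subset by blast
    have "(\<Sum>f\<in>F. (1/2::real) ^ card (edges_of f)) = card F * c"
      using F by (subst sum.cong[OF refl, of _ _ "\<lambda>_. c"]) (auto simp: c_def card_edges_of)
    also have "\<dots> \<ge> \<mu>" using cF c by (simp add: \<mu>_def)
    finally show "\<mu> \<le> (\<Sum>f\<in>F. (1/2::real) ^ card (edges_of f))" .
    have "(\<Sum>f\<in>F. \<Sum>g\<in>{g\<in>F. edges_of f \<inter> edges_of g \<noteq> {}}. (1/2::real) ^ card (edges_of f \<union> edges_of g))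
      \<le> (\<Sum>f\<in>F. \<Sum>g\<in>{g\<in>transversals. edges_of f \<inter> edges_of g \<noteq> {}}. (1/2::real) ^ card (edges_of f \<union> edges_of g))"
      using F finite_transversals by (intro sum_mono sum_mono2) auto
    also have "\<dots> \<le> (\<Sum>f\<in>transversals. \<Sum>g\<in>{g\<in>transversals. edges_of f \<inter> edges_of g \<noteq> {}}. (1/2::real) ^ card (edges_of f \<union> edges_of g))"
      using F finite_transversals by (intro sum_mono2 sum_nonneg) auto
    also have "\<dots> \<le> card transversals * ((1/2) ^ (2 * (s choose 2)) * t ^ s * (3 / 2 ^ (s + 3)))"
      using pair_sum_bound[OF _ s t] by (intro sum_bounded_above)
    also have "\<dots> = \<Delta>"
      unfolding \<Delta>_def c_def card_transversals by (simp add: power_even_eq)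
    finally show "(\<Sum>f\<in>F. \<Sum>g\<in>{g\<in>F. edges_of f \<inter> edges_of g \<noteq> {}}. (1/2::real) ^ card (edges_of f \<union> edges_of g)) \<le> \<Delta>" .
    show "0 \<le> \<mu>" "0 < \<Delta>" using c t0 by (auto simp: \<mu>_def \<Delta>_def)
    \<comment> \<open>The case \<open>i = s\<close> of the weight estimate: the expected number
      \<open>c * t ^ s\<close> of cliques among all transversals is at least
      \<open>2 ^ (s + 3)\<close>, which yields \<open>\<mu> \<le> \<Delta>\<close>.\<close>
    have "2 \<le> s" using s by presburger
    then have "s ^ s * (2 ^ (s choose 2) * 2 ^ (s + 3)) \<le> t ^ s"
      using transversal_pair_weight[OF s(1) t _ order_refl] by (simp only: mult.assoc)
    moreover have "1 * (2 ^ (s choose 2) * 2 ^ (s + 3)) \<le> s ^ s * (2 ^ (s choose 2) * 2 ^ (s + 3))"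
      using s(2) by (intro mult_right_mono) auto
    ultimately have "2 ^ (s choose 2) * 2 ^ (s + 3) \<le> t ^ s" by linarith
    then have "real (2 ^ (s choose 2) * 2 ^ (s + 3)) \<le> real (t ^ s)"
      by (simp only: of_nat_le_iff)
    then have "2 ^ (s choose 2) * 2 ^ (s + 3) \<le> real t ^ s" by simp
    then have "2 ^ (s + 3) \<le> c * real t ^ s"
      by (simp add: c_def power_divide field_simps)
    then have "t ^ s * c / 2 * 2 ^ (s + 3) \<le> t ^ s * c * 3 * (c * real t ^ s)"
      using c by (intro mult_mono) (auto simp: field_simps)
    then show "\<mu> \<le> \<Delta>"
      by (simp add: \<mu>_def \<Delta>_def field_simps power2_eq_square)
  qed
  also have "- \<mu>\<^sup>2 / (2 * \<Delta>) = - (2 ^ s / 3)"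
    using c t0 by (simp add: \<mu>_def \<Delta>_def field_simps power2_eq_square power_add)
  finally show ?thesis .
qed

end

section \<open>Neighbourhoods\<close>

text \<open>These are potential edges, present in the graph or not. Stars at distinct centres
  outside \<open>K\<close> are disjoint blocks, so the adjacencies of different vertices to
  \<open>K\<close> are independent.\<close>

definition star :: "'a \<Rightarrow> 'a set \<Rightarrow> 'a set set" where
  "star u K = (\<lambda>w. {u, w}) ` K"

lemma card_star: "card (star u K) = card K"
  unfolding star_def by (intro card_image) (auto simp: inj_on_def doubleton_eq_iff)

lemma star_subset: "u \<in> V \<Longrightarrow> K \<subseteq> V \<Longrightarrow> u \<notin> K \<Longrightarrow> star u K \<subseteq> [V]\<^bsup>2\<^esup>"
  by (auto simp: star_def)

lemma star_disjoint: "R \<inter> K = {} \<Longrightarrow> disjoint_family_on (\<lambda>u. star u K) R"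
  unfolding disjoint_family_on_def star_def by (auto simp: doubleton_eq_iff)

lemma star_subset_iff: "star u K \<subseteq> E \<longleftrightarrow> (\<forall>w\<in>K. {u, w} \<in> E)"
  by (auto simp: star_def)

lemma star_disjoint_iff: "E \<inter> star u K = {} \<longleftrightarrow> (\<forall>w\<in>K. {u, w} \<notin> E)"
  by (auto simp: star_def)

lemma avg_stars:
  assumes "finite V" "K \<subseteq> V" "R \<subseteq> V - K"
  shows "avg ([V]\<^bsup>2\<^esup>) (\<lambda>E. \<Prod>u\<in>R. f u (E \<inter> star u K)) = (\<Prod>u\<in>R. avg (star u K) (f u))"
  using assms
  by (intro avg_blocks star_disjoint finite_imp_finite_nsets star_subset)
     (auto intro: finite_subset)

lemma finite_star: "finite K \<Longrightarrow> finite (star u K)"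
  by (simp add: star_def)

lemma avg_star_missing:
  assumes "finite K"
  shows "avg (star u K) (\<lambda>X. of_bool (\<not> star u K \<subseteq> X)) = 1 - (1/2) ^ card K"
proof -
  have "avg (star u K) (\<lambda>X. of_bool (\<not> star u K \<subseteq> X)) = avg (star u K) (\<lambda>X. 1 - of_bool (star u K \<subseteq> X))"
    by (intro avg_cong) auto
  also have "\<dots> = 1 - (1/2) ^ card (star u K)"
    using avg_superset[OF finite_star[OF assms] order_refl] finite_star[OF assms, of u]
    by (simp add: avg_diff)
  finally show ?thesis by (simp add: card_star)
qed

lemma prod_of_bool:
  "finite R \<Longrightarrow> (\<Prod>u\<in>R. of_bool (P u) :: real) = of_bool (\<forall>u\<in>R. P u)"
  by (induction R rule: finite_induct) auto

lemma prob_no_common_neighbour: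
  assumes "finite V" "K \<subseteq> V" "R \<subseteq> V - K"
  shows "avg ([V]\<^bsup>2\<^esup>) (\<lambda>E. of_bool (\<forall>u\<in>R. \<exists>w\<in>K. {u, w} \<notin> E)) = (1 - (1/2) ^ card K) ^ card R"
proof -
  have "finite R" "finite K" using assms by (auto intro: finite_subset)
  have "avg ([V]\<^bsup>2\<^esup>) (\<lambda>E. of_bool (\<forall>u\<in>R. \<exists>w\<in>K. {u, w} \<notin> E))
      = avg ([V]\<^bsup>2\<^esup>) (\<lambda>E. \<Prod>u\<in>R. (\<lambda>u Y. of_bool (\<not> star u K \<subseteq> Y)) u (E \<inter> star u K))"
    using \<open>finite R\<close> by (intro avg_cong) (auto simp: star_subset_iff prod_of_bool)
  also have "\<dots> = (\<Prod>u\<in>R. avg (star u K) (\<lambda>Y. of_bool (\<not> star u K \<subseteq> Y)))"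
    by (rule avg_stars[OF assms])
  finally show ?thesis by (simp add: avg_star_missing[OF \<open>finite K\<close>])
qed

text \<open>
  A Chernoff bound (exponential moment at \<open>1/2\<close>); a union bound over the set of non-neighbours would lose
  a factor \<open>ln n\<close>.
\<close>

lemma prob_few_nonneighbours:
  assumes "finite V" "W \<subseteq> V"
  shows "avg ([V]\<^bsup>2\<^esup>) (\<lambda>E. of_bool (card {u\<in>V - W. \<forall>w\<in>W. {u, w} \<notin> E} < m))
      \<le> 2 ^ m * exp (- ((card V - card W) / 2 ^ (card W + 1)))"
proof -
  let ?k = "card W" and ?U = "\<lambda>E. {u\<in>V - W. \<forall>w\<in>W. {u, w} \<notin> E}"
  have fin: "finite (V - W)" "finite W" using assms by (auto intro: finite_subset)
  have "avg ([V]\<^bsup>2\<^esup>) (\<lambda>E. of_bool (card (?U E) < m)) \<le> avg ([V]\<^bsup>2\<^esup>) (\<lambda>E. 2 ^ m * (1/2) ^ card (?U E))"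
  proof (rule avg_mono)
    fix E
    show "(of_bool (card (?U E) < m) :: real) \<le> 2 ^ m * (1/2) ^ card (?U E)"
      using power_increasing[of "card (?U E)" m "2::real"]
      by (cases "card (?U E) < m") (auto simp: power_divide)
  qed
  also have "\<dots> = 2 ^ m * avg ([V]\<^bsup>2\<^esup>) (\<lambda>E. (1/2) ^ card (?U E))"
    by (rule avg_cmult)
  also have "avg ([V]\<^bsup>2\<^esup>) (\<lambda>E. (1/2) ^ card (?U E))
      = avg ([V]\<^bsup>2\<^esup>) (\<lambda>E. \<Prod>u\<in>V-W. (\<lambda>u Y. 1 - 1/2 * of_bool (Y = {})) u (E \<inter> star u W))"
  proof (rule avg_cong)
    fix E
    have "(\<Prod>u\<in>V-W. 1 - 1/2 * of_bool (E \<inter> star u W = {}) :: real)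
        = (\<Prod>u\<in>V-W. if \<forall>w\<in>W. {u, w} \<notin> E then 1/2 else 1)"
      by (intro prod.cong) (auto simp: star_disjoint_iff)
    also have "\<dots> = (1/2) ^ card (?U E)"
      using fin by (simp add: prod.If_cases Int_def)
    finally show "(1/2) ^ card (?U E)
        = (\<Prod>u\<in>V-W. (\<lambda>u Y. 1 - 1/2 * of_bool (Y = {}) :: real) u (E \<inter> star u W))" by simp
  qed
  also have "\<dots> = (\<Prod>u\<in>V-W. avg (star u W) (\<lambda>Y. 1 - 1/2 * of_bool (Y = {})))"
    by (rule avg_stars) (use assms in auto)
  also have "\<dots> = (\<Prod>u\<in>V-W. 1 - 1/2 * (1/2) ^ ?k)"
  proof (rule prod.cong[OF refl])
    fix u
    have "avg (star u W) (\<lambda>Y. of_bool (Y = {})) = avg (star u W) (\<lambda>Y. of_bool (Y \<inter> star u W = {}))"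
      by (intro avg_cong) (auto simp: Int_absorb2)
    also have "\<dots> = (1/2) ^ ?k"
      using avg_of_bool_eq[OF finite_star[OF fin(2)] order_refl, of "{}" u] by (simp add: card_star)
    finally show "avg (star u W) (\<lambda>Y. 1 - 1/2 * of_bool (Y = {})) = 1 - 1/2 * (1/2) ^ ?k"
      using finite_star[OF fin(2), of u] by (simp only: avg_diff avg_const avg_cmult)
  qed
  also have "\<dots> = (1 - 1 / 2 ^ (?k + 1)) ^ (card V - ?k)"
    using fin assms by (simp add: card_Diff_subset power_divide)
  also have "\<dots> \<le> exp (- (1 / 2 ^ (?k + 1))) ^ (card V - ?k)"
    using exp_ge_add_one_self[of "- (1 / 2 ^ (?k + 1))"] one_le_power[of "2::real" "?k + 1"]
    by (intro power_mono) (auto simp: field_simps)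
  also have "\<dots> = exp (- ((card V - ?k) / 2 ^ (?k + 1)))"
    using card_mono[OF assms] by (simp add: of_nat_diff flip: exp_of_nat_mult)
  finally show ?thesis by simp
qed

text \<open>The first two conditions prescribe every pair in \<open>A\<close>, the third involves
  only pairs in \<open>B\<close>; the blocks are disjoint, so the probability is an exact product.
  For nonempty \<open>K\<close> no vertex of \<open>Z\<close> can be a common neighbour, hence the
  range \<open>V - Z - K\<close>.\<close>

lemma prob_isolated_maximal_clique:
  assumes "finite V" "Z \<subseteq> V" "K \<subseteq> V" "Z \<inter> K = {}"
  shows "avg ([V]\<^bsup>2\<^esup>) (\<lambda>E. of_bool ((\<forall>x\<in>K. \<forall>z\<in>Z. {x, z} \<notin> E) \<and> clique K E
            \<and> (\<forall>u\<in>V - Z - K. \<exists>x\<in>K. {u, x} \<notin> E)))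
      = (1/2) ^ (card K * card Z + (card K choose 2)) * (1 - (1/2) ^ card K) ^ (card V - card Z - card K)"
proof -
  have fin: "finite Z" "finite K" using assms by (auto intro: finite_subset)
  define C where "C = (\<Union>x\<in>K. star x Z)"
  define A where "A = C \<union> [K]\<^bsup>2\<^esup>"
  define R where "R = V - Z - K"
  define B where "B = (\<Union>u\<in>R. star u K)"
  have C: "C \<inter> [K]\<^bsup>2\<^esup> = {}" "C \<subseteq> [V]\<^bsup>2\<^esup>"
    using assms unfolding C_def star_def by fastforce+
  have "[K]\<^bsup>2\<^esup> \<subseteq> [V]\<^bsup>2\<^esup>" using assms by (intro nsets_mono)
  then have A: "A \<subseteq> [V]\<^bsup>2\<^esup>" using C by (auto simp: A_def)
  have B: "B \<subseteq> [V]\<^bsup>2\<^esup>" "A \<inter> B = {}"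
    using assms unfolding A_def C_def B_def R_def star_def by (auto simp: doubleton_eq_iff)
  have finV: "finite ([V]\<^bsup>2\<^esup>)" using assms by (intro finite_imp_finite_nsets)
  have "card C = (\<Sum>x\<in>K. card (star x Z))"
    unfolding C_def using star_disjoint[of K Z] assms fin
    by (intro card_UN_disjoint) (auto simp: finite_star disjoint_family_on_def)
  then have cardC: "card C = card K * card Z" by (simp add: card_star)
  have cardA: "card A = card K * card Z + (card K choose 2)"
    unfolding A_def using C fin cardC
    by (subst card_Un_disjoint) (auto simp: C_def finite_star finite_imp_finite_nsets)
  have cliq: "clique K E \<longleftrightarrow> [K]\<^bsup>2\<^esup> \<subseteq> E" for E
    unfolding clique_def by (force elim!: nsets2_E)
  have inside: "(\<forall>x\<in>K. \<forall>z\<in>Z. {x, z} \<notin> E) \<and> clique K E \<longleftrightarrow> E \<inter> A = [K]\<^bsup>2\<^esup>" for E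
  proof -
    have "(\<forall>x\<in>K. \<forall>z\<in>Z. {x, z} \<notin> E) \<longleftrightarrow> E \<inter> C = {}"
      unfolding C_def star_def by auto
    then show ?thesis unfolding cliq A_def using C(1) by blast
  qed
  have outside: "(\<forall>u\<in>R. \<exists>x\<in>K. {u, x} \<notin> E \<inter> B) \<longleftrightarrow> (\<forall>u\<in>R. \<exists>x\<in>K. {u, x} \<notin> E)" for E
    by (auto simp: B_def star_def)
  have "avg ([V]\<^bsup>2\<^esup>) (\<lambda>E. of_bool ((\<forall>x\<in>K. \<forall>z\<in>Z. {x, z} \<notin> E) \<and> clique K E
            \<and> (\<forall>u\<in>V - Z - K. \<exists>x\<in>K. {u, x} \<notin> E)))
      = avg ([V]\<^bsup>2\<^esup>) (\<lambda>E. (\<lambda>Y. of_bool (Y = [K]\<^bsup>2\<^esup>)) (E \<inter> A)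
          * (\<lambda>Y. of_bool (\<forall>u\<in>R. \<exists>x\<in>K. {u, x} \<notin> Y)) (E \<inter> B))"
    unfolding outside R_def[symmetric] inside[symmetric] of_bool_conj[symmetric] conj_assoc ..
  also have "\<dots> = avg A (\<lambda>Y. of_bool (Y = [K]\<^bsup>2\<^esup>)) * avg B (\<lambda>Y. of_bool (\<forall>u\<in>R. \<exists>x\<in>K. {u, x} \<notin> Y))"
    by (rule avg_indep[OF finV A B])
  also have "avg A (\<lambda>Y. of_bool (Y = [K]\<^bsup>2\<^esup>)) = avg ([V]\<^bsup>2\<^esup>) (\<lambda>E. of_bool (E \<inter> A = [K]\<^bsup>2\<^esup>))"
    by (rule avg_restrict[OF finV A, symmetric])
  also have "\<dots> = (1/2) ^ card A"
    by (rule avg_of_bool_eq[OF finV A]) (auto simp: A_def)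
  also have "avg B (\<lambda>Y. of_bool (\<forall>u\<in>R. \<exists>x\<in>K. {u, x} \<notin> Y))
      = avg ([V]\<^bsup>2\<^esup>) (\<lambda>E. of_bool (\<forall>u\<in>R. \<exists>x\<in>K. {u, x} \<notin> E \<inter> B))"
    by (rule avg_restrict[OF finV B(1), symmetric])
  also have "\<dots> = avg ([V]\<^bsup>2\<^esup>) (\<lambda>E. of_bool (\<forall>u\<in>R. \<exists>x\<in>K. {u, x} \<notin> E))"
    unfolding outside ..
  also have "\<dots> = (1 - (1/2) ^ card K) ^ card R"
    by (rule prob_no_common_neighbour) (use assms in \<open>auto simp: R_def\<close>)
  also have "card R = card V - card Z - card K"
    unfolding R_def using assms fin by (subst card_Diff_subset; auto)+
  finally show ?thesis by (simp add: cardA)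
qed

text \<open>Summed over \<open>W\<close>, the condition forces at least
  \<open>\<theta> * card B * card W\<close> edges between \<open>B\<close> and \<open>W\<close>, and
  Markov's inequality is applied to \<open>x\<close> raised to their number. The parameter
  \<open>x\<close> stays free because it is taken near 1 when \<open>\<theta>\<close> is close to
  1/2, and equal to 16 when \<open>\<theta>\<close> is close to 1.\<close>

lemma prob_dense_pair:
  fixes \<theta> x :: real
  assumes "finite V" "B \<subseteq> V" "W \<subseteq> V - B" "1 \<le> x"
  shows "avg ([V]\<^bsup>2\<^esup>) (\<lambda>E. of_bool (\<forall>w\<in>W. \<theta> * card B \<le> card {y\<in>B. {w, y} \<in> E}))
      \<le> (((1 + x) / 2) / x powr \<theta>) ^ (card B * card W)"
proof -
  let ?T = "\<Union>w\<in>W. star w B"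
  have fin: "finite B" "finite W" using assms by (auto intro: finite_subset)
  have T: "?T \<subseteq> [V]\<^bsup>2\<^esup>" using assms star_subset[of _ V B] by blast
  have disj: "disjoint_family_on (\<lambda>w. star w B) W"
    using assms by (intro star_disjoint) auto
  have cardT: "card ?T = card B * card W"
  proof -
    have "card ?T = (\<Sum>w\<in>W. card (star w B))"
      using disj fin by (intro card_UN_disjoint) (auto simp: finite_star disjoint_family_on_def)
    then show ?thesis by (simp add: card_star)
  qed
  have cardET: "card (E \<inter> ?T) = (\<Sum>w\<in>W. card {y\<in>B. {w, y} \<in> E})" for E
  proof -
    have "E \<inter> ?T = (\<Union>w\<in>W. star w {y\<in>B. {w, y} \<in> E})"
      by (auto simp: star_def)
    also have "card \<dots> = (\<Sum>w\<in>W. card (star w {y\<in>B. {w, y} \<in> E}))"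
    proof (rule card_UN_disjoint)
      show "\<forall>i\<in>W. \<forall>j\<in>W. i \<noteq> j \<longrightarrow> star i {y \<in> B. {i, y} \<in> E} \<inter> star j {y \<in> B. {j, y} \<in> E} = {}"
        using disj unfolding disjoint_family_on_def star_def by blast
    qed (use fin in \<open>auto intro: finite_star\<close>)
    finally show ?thesis by (simp add: card_star)
  qed
  have "avg ([V]\<^bsup>2\<^esup>) (\<lambda>E. of_bool (\<forall>w\<in>W. \<theta> * card B \<le> card {y\<in>B. {w, y} \<in> E}))
      \<le> avg ([V]\<^bsup>2\<^esup>) (\<lambda>E. x ^ card (E \<inter> ?T) * (1 / (x powr \<theta>) ^ (card B * card W)))"
  proof (rule avg_mono)
    fix E
    show "(of_bool (\<forall>w\<in>W. \<theta> * card B \<le> card {y\<in>B. {w, y} \<in> E}) :: real)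
       \<le> x ^ card (E \<inter> ?T) * (1 / (x powr \<theta>) ^ (card B * card W))"
    proof (cases "\<forall>w\<in>W. \<theta> * card B \<le> card {y\<in>B. {w, y} \<in> E}")
      case True
      have "(\<Sum>w\<in>W. \<theta> * card B) \<le> (\<Sum>w\<in>W. real (card {y\<in>B. {w, y} \<in> E}))"
        using True by (intro sum_mono) auto
      then have *: "\<theta> * (card B * card W) \<le> card (E \<inter> ?T)"
        by (simp add: cardET mult_ac)
      have "(x powr \<theta>) ^ (card B * card W) = x powr (\<theta> * (card B * card W))"
        using assms(4) by (simp add: powr_powr flip: powr_realpow)
      also have "\<dots> \<le> x powr card (E \<inter> ?T)"
        using assms(4) * by (intro powr_mono) auto
      also have "\<dots> = x ^ card (E \<inter> ?T)"
        using assms(4) by (simp add: powr_realpow)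
      finally show ?thesis using assms(4) by (simp add: field_simps)
    next
      case False
      have "0 \<le> x ^ card (E \<inter> ?T) * (1 / (x powr \<theta>) ^ (card B * card W))"
        using assms(4) by (intro mult_nonneg_nonneg) auto
      then show ?thesis unfolding of_bool_def if_not_P[OF False] .
    qed
  qed
  also have "\<dots> = ((1 + x) / 2) ^ card ?T * (1 / (x powr \<theta>) ^ (card B * card W))"
    unfolding avg_multc using assms T by (subst avg_power_card) (auto intro: finite_imp_finite_nsets)
  also have "\<dots> = (((1 + x) / 2) / x powr \<theta>) ^ (card B * card W)"
    by (simp add: cardT power_divide)
  finally show ?thesis .
qed

text \<open>Needed at two scales: for all parts together with a threshold just above 1/2, and for
  the first \<open>d\<close> parts with a threshold near 1.\<close>

definition has_dense_pair :: "'a set \<Rightarrow> 'a set set \<Rightarrow> nat \<Rightarrow> nat \<Rightarrow> real \<Rightarrow> bool" where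
  "has_dense_pair V E b m \<theta> \<longleftrightarrow> (\<exists>B W. B \<subseteq> V \<and> card B = b \<and> W \<subseteq> V - B \<and> card W = m
      \<and> (\<forall>w\<in>W. \<theta> * b \<le> card {y\<in>B. {w, y} \<in> E}))"

lemma prob_has_dense_pair:
  fixes \<theta> x :: real
  assumes "finite V" "1 \<le> x"
  shows "avg ([V]\<^bsup>2\<^esup>) (\<lambda>E. of_bool (has_dense_pair V E b m \<theta>))
      \<le> real ((card V choose b) * (card V choose m)) * (((1 + x) / 2) / x powr \<theta>) ^ (b * m)"
proof -
  define I where "I = {(B, W). B \<subseteq> V \<and> card B = b \<and> W \<subseteq> V - B \<and> card W = m}"
  have sub: "I \<subseteq> {B. B \<subseteq> V \<and> card B = b} \<times> {W. W \<subseteq> V \<and> card W = m}"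
    by (auto simp: I_def)
  have finp: "finite {B. B \<subseteq> V \<and> card B = j}" for j using assms by simp
  have fin: "finite I" using finite_subset[OF sub] finp by blast
  have "card I \<le> (card V choose b) * (card V choose m)"
    using card_mono[OF _ sub] finp by (simp add: n_subsets assms(1) card_cartesian_product)
  then have cI: "real (card I) \<le> real ((card V choose b) * (card V choose m))"
    by (simp only: of_nat_le_iff)
  have "avg ([V]\<^bsup>2\<^esup>) (\<lambda>E. of_bool (has_dense_pair V E b m \<theta>))
      = avg ([V]\<^bsup>2\<^esup>) (\<lambda>E. of_bool (\<exists>i\<in>I. case i of (B, W) \<Rightarrow> \<forall>w\<in>W. \<theta> * b \<le> card {y\<in>B. {w, y} \<in> E}))"
    unfolding has_dense_pair_def I_def by (intro avg_cong arg_cong[where f=of_bool]) auto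
  also have "\<dots> \<le> real ((card V choose b) * (card V choose m)) * (((1 + x) / 2) / x powr \<theta>) ^ (b * m)"
  proof (rule avg_union_bound_card[OF fin _ cI])
    fix i assume "i \<in> I"
    then show "avg ([V]\<^bsup>2\<^esup>) (\<lambda>E. of_bool (case i of (B, W) \<Rightarrow> \<forall>w\<in>W. \<theta> * b \<le> card {y\<in>B. {w, y} \<in> E}))
        \<le> (((1 + x) / 2) / x powr \<theta>) ^ (b * m)"
      using prob_dense_pair[OF assms(1) _ _ assms(2), of "fst i" "snd i" \<theta>] by (auto simp: I_def)
  qed (use assms in auto)
  finally show ?thesis .
qed

definition has_few_nonneighbours :: "'a set \<Rightarrow> 'a set set \<Rightarrow> nat \<Rightarrow> nat \<Rightarrow> bool" where
  "has_few_nonneighbours V E k m \<longleftrightarrow> (\<exists>W. W \<subseteq> V \<and> card W = k \<and> card {u\<in>V - W. \<forall>w\<in>W. {u, w} \<notin> E} < m)"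

lemma prob_has_few_nonneighbours:
  assumes "finite V"
  shows "avg ([V]\<^bsup>2\<^esup>) (\<lambda>E. of_bool (has_few_nonneighbours V E k m))
      \<le> real (card V choose k) * (2 ^ m * exp (- ((card V - k) / 2 ^ (k + 1))))"
proof -
  define I where "I = {W. W \<subseteq> V \<and> card W = k}"
  have fin: "finite I" using assms by (simp add: I_def)
  have cI: "real (card I) \<le> real (card V choose k)"
    using assms by (simp add: I_def n_subsets)
  have "avg ([V]\<^bsup>2\<^esup>) (\<lambda>E. of_bool (has_few_nonneighbours V E k m))
      = avg ([V]\<^bsup>2\<^esup>) (\<lambda>E. of_bool (\<exists>W\<in>I. card {u\<in>V - W. \<forall>w\<in>W. {u, w} \<notin> E} < m))"
    unfolding has_few_nonneighbours_def I_def by (intro avg_cong arg_cong[where f=of_bool]) auto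
  also have "\<dots> \<le> real (card V choose k) * (2 ^ m * exp (- ((card V - k) / 2 ^ (k + 1))))"
    using prob_few_nonneighbours[OF assms]
    by (intro avg_union_bound_card[OF fin _ cI]) (auto simp: I_def)
  finally show ?thesis .
qed

section \<open>Transversals without common neighbour\<close>

text \<open>Only vertices outside the parts are tested. Membership is therefore decided by pairs
  that leave the union of the parts and is independent of the pairs inside it, which decide whether
  a transversal is a clique.\<close>

definition free_transversals :: "'a set \<Rightarrow> 'a set set \<Rightarrow> nat \<Rightarrow> (nat \<Rightarrow> 'a set) \<Rightarrow> (nat \<Rightarrow> 'a) set" where
  "free_transversals V E s A =
     {f \<in> PiE {..<s} A. \<forall>w\<in>V - (\<Union>j<s. A j). \<exists>j<s. {w, f j} \<notin> E}"

text \<open>Extensional functions make the number of families of parts finite, as the union bound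
  requires.\<close>

definition has_bad_parts :: "'a set \<Rightarrow> 'a set set \<Rightarrow> nat \<Rightarrow> nat \<Rightarrow> bool" where
  "has_bad_parts V E s t \<longleftrightarrow> (\<exists>A \<in> PiE {..<s} (\<lambda>_. {B. B \<subseteq> V \<and> card B = t}).
      disjoint_family_on A {..<s} \<and> t ^ s \<le> 2 * card (free_transversals V E s A)
      \<and> (\<forall>f\<in>free_transversals V E s A. \<not> [f ` {..<s}]\<^bsup>2\<^esup> \<subseteq> E))"

text \<open>For fixed parts the pairs in \<open>S2\<close> are exposed first. They determine the
  free transversals; if these make up at least half of all transversals,
  \<open>transversal_clique\<close> applies to the still random pairs in \<open>S1\<close>. The
  factor in front bounds the number of choices of the parts.\<close>

lemma prob_has_bad_parts:
  assumes V: "finite V" and s: "s = 2 * h" "0 < s" and t: "s * 2 ^ (h + 2) \<le> t"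
  shows "avg ([V]\<^bsup>2\<^esup>) (\<lambda>E. of_bool (has_bad_parts V E s t)) \<le> real (card V) ^ (t * s) * exp (- (2 ^ s / 3))"
proof -
  define I where "I = {A \<in> PiE {..<s} (\<lambda>_. {B. B \<subseteq> V \<and> card B = t}). disjoint_family_on A {..<s}}"
  define Q where "Q A E \<longleftrightarrow> t ^ s \<le> 2 * card (free_transversals V E s A)
      \<and> (\<forall>f\<in>free_transversals V E s A. \<not> [f ` {..<s}]\<^bsup>2\<^esup> \<subseteq> E)" for A E
  have finP: "finite (PiE {..<s} (\<lambda>_. {B. B \<subseteq> V \<and> card B = t}))"
    using V by (intro finite_PiE) auto
  have fin: "finite I" unfolding I_def using finP by auto
  have "card I \<le> card (PiE {..<s} (\<lambda>_. {B. B \<subseteq> V \<and> card B = t}))"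
    unfolding I_def using finP by (intro card_mono) auto
  also have "\<dots> = (card V choose t) ^ s"
    using V by (simp add: card_PiE n_subsets)
  also have "\<dots> \<le> (card V ^ t) ^ s"
  proof (intro power_mono)
    have "(card V choose t) * 1 \<le> (card V choose t) * fact t"
      by (intro mult_left_mono fact_ge_1) auto
    then show "(card V choose t) \<le> card V ^ t"
      using binomial_fact_pow[of "card V" t] by linarith
  qed auto
  also have "\<dots> = card V ^ (t * s)" by (simp add: power_mult)
  finally have "real (card I) \<le> real (card V ^ (t * s))" by (simp only: of_nat_le_iff)
  then have cI: "real (card I) \<le> real (card V) ^ (t * s)" by simp
  have "avg ([V]\<^bsup>2\<^esup>) (\<lambda>E. of_bool (has_bad_parts V E s t)) = avg ([V]\<^bsup>2\<^esup>) (\<lambda>E. of_bool (\<exists>A\<in>I. Q A E))"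
    unfolding has_bad_parts_def I_def Q_def by (intro avg_cong arg_cong[where f=of_bool]) auto
  also have "\<dots> \<le> real (card V) ^ (t * s) * exp (- (2 ^ s / 3))"
  proof (rule avg_union_bound_card[OF fin _ cI])
    fix A assume A: "A \<in> I"
    have AV: "j < s \<Longrightarrow> A j \<subseteq> V" and cA: "j < s \<Longrightarrow> card (A j) = t" for j
      using A by (auto simp: I_def)
    have "parts s t A"
      using A AV cA V by unfold_locales (auto simp: I_def intro: finite_subset)
    then interpret parts s t A .
    let ?U = "\<Union>j<s. A j"
    define S1 where "S1 = [?U]\<^bsup>2\<^esup>"
    define S2 where "S2 = [V]\<^bsup>2\<^esup> - S1"
    have "?U \<subseteq> V" using AV by blast
    then have S: "[V]\<^bsup>2\<^esup> = S2 \<union> S1" "S2 \<inter> S1 = {}"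
      using nsets_mono[of ?U V 2] by (auto simp: S1_def S2_def)
    have finS: "finite S1" "finite S2"
      using V \<open>?U \<subseteq> V\<close> by (auto simp: S1_def S2_def intro: finite_imp_finite_nsets finite_subset)
    have free: "free_transversals V (Y \<union> X) s A = free_transversals V Y s A"
      if "X \<subseteq> S1" for X Y
    proof -
      have "{w, y} \<notin> X" if "w \<in> V - ?U" for w y
        using that \<open>X \<subseteq> S1\<close> by (auto simp: S1_def)
      then show ?thesis unfolding free_transversals_def by blast
    qed
    have freesub: "free_transversals V Y s A \<subseteq> transversals" for Y
      by (auto simp: free_transversals_def transversals_def)
    have edges: "[f ` {..<s}]\<^bsup>2\<^esup> \<subseteq> Y \<union> X \<longleftrightarrow> edges_of f \<subseteq> X"
      if "f \<in> free_transversals V Y s A" "Y \<subseteq> S2" for f X Y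
      using edges_of_subset[of f] freesub that S(2) unfolding edges_of_def S1_def by blast
    have "avg ([V]\<^bsup>2\<^esup>) (\<lambda>E. of_bool (Q A E)) = avg S2 (\<lambda>Y. avg S1 (\<lambda>X. of_bool (Q A (Y \<union> X))))"
      unfolding S(1) by (rule avg_union[OF finS(2,1) S(2)])
    also have "\<dots> \<le> avg S2 (\<lambda>Y. exp (- (2 ^ s / 3)))"
    proof (rule avg_mono)
      fix Y assume Y: "Y \<subseteq> S2"
      let ?F = "free_transversals V Y s A"
      have "avg S1 (\<lambda>X. of_bool (Q A (Y \<union> X)))
          = avg S1 (\<lambda>X. of_bool (t ^ s \<le> 2 * card ?F) * of_bool (\<forall>f\<in>?F. \<not> edges_of f \<subseteq> X))"
        unfolding Q_def using free edges Y by (intro avg_cong) (auto simp flip: of_bool_conj)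
      also have "\<dots> = of_bool (t ^ s \<le> 2 * card ?F) * avg S1 (\<lambda>X. of_bool (\<forall>f\<in>?F. \<not> edges_of f \<subseteq> X))"
        by (rule avg_cmult)
      also have "\<dots> \<le> exp (- (2 ^ s / 3))"
        using transversal_clique[OF s t freesub] unfolding S1_def
        by (cases "t ^ s \<le> 2 * card ?F") auto
      finally show "avg S1 (\<lambda>X. of_bool (Q A (Y \<union> X))) \<le> exp (- (2 ^ s / 3))" .
    qed
    also have "\<dots> = exp (- (2 ^ s / 3))" using finS by simp
    finally show "avg ([V]\<^bsup>2\<^esup>) (\<lambda>E. of_bool (Q A E)) \<le> exp (- (2 ^ s / 3))" .
  qed auto
  finally show ?thesis .
qed

section \<open>Few colours do not suffice\<close>

text \<open>AM-GM by multiplying the tangent inequalities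
  \<open>x j / a \<le> exp (x j / a - 1)\<close>, whose exponents add up to at most 0. For
  \<open>a \<le> 0\<close> and \<open>p > 0\<close> the hypotheses leave only \<open>a = 0\<close>
  and vanishing \<open>x j\<close>.\<close>

lemma prod_le_mean_power:
  fixes x :: "nat \<Rightarrow> real" and a :: real
  assumes "\<And>j. j < p \<Longrightarrow> 0 \<le> x j" "(\<Sum>j<p. x j) \<le> p * a"
  shows "(\<Prod>j<p. x j) \<le> a ^ p"
proof (cases "a \<le> 0")
  case True
  have sum0: "(\<Sum>j<p. x j) \<ge> 0" using assms(1) by (intro sum_nonneg) auto
  show ?thesis
  proof (cases "p = 0")
    case False
    have "p * a \<le> 0" using True by (intro mult_nonneg_nonpos) auto
    then have "(\<Sum>j<p. x j) = 0" "p * a = 0" using sum0 assms(2) by linarith+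
    then have "x 0 = 0" "a = 0"
      using False assms(1) sum_nonneg_eq_0_iff[of "{..<p}" x] by auto
    have "(\<Prod>j<p. x j) = 0"
      using \<open>x 0 = 0\<close> False by (intro prod_zero) auto
    then show ?thesis unfolding \<open>a = 0\<close> by (simp only: zero_le_power order_refl)
  qed simp
next
  case False
  have "(\<Prod>j<p. x j) \<le> (\<Prod>j<p. a * exp (x j / a - 1))"
  proof (intro prod_mono conjI)
    fix j
    have "x j / a \<le> exp (x j / a - 1)"
      using exp_ge_add_one_self[of "x j / a - 1"] by simp
    then show "x j \<le> a * exp (x j / a - 1)"
      using False by (simp add: field_simps)
  qed (use assms in auto)
  also have "\<dots> = a ^ p * exp (\<Sum>j<p. x j / a - 1)"
    by (simp add: prod.distrib exp_sum)
  also have "(\<Sum>j<p. x j / a - 1) = (\<Sum>j<p. x j) / a - p"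
    by (simp add: sum_subtractf sum_divide_distrib)
  also have "a ^ p * exp ((\<Sum>j<p. x j) / a - p) \<le> a ^ p * 1"
    using False assms(2) by (intro mult_left_mono) (auto simp: field_simps)
  finally show ?thesis by simp
qed

text \<open>Greedy choice: before part \<open>p\<close> is chosen, the earlier parts occupy at most
  \<open>p * t \<le> (s - 1) * t\<close> elements, so \<open>t\<close> of the \<open>s * t\<close>
  elements of \<open>X p\<close> remain.\<close>

lemma extend_disjoint_parts:
  assumes X: "\<And>j. j < s \<Longrightarrow> s * t \<le> card (X j)"
    and A: "disjoint_family_on A {..<d}" "\<And>j. j < d \<Longrightarrow> A j \<subseteq> X j \<and> card (A j) = t"
    and d: "d \<le> s" and "0 < t"
  obtains A' where "\<And>j. j < d \<Longrightarrow> A' j = A j" "disjoint_family_on A' {..<s}"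
    "\<And>j. j < s \<Longrightarrow> A' j \<subseteq> X j \<and> card (A' j) = t"
proof -
  have "\<exists>A'. (\<forall>j<d. A' j = A j) \<and> disjoint_family_on A' {..<p} \<and> (\<forall>j<p. A' j \<subseteq> X j \<and> card (A' j) = t)"
    if "d \<le> p" "p \<le> s" for p
    using that
  proof (induction p rule: dec_induct)
    case base
    then show ?case using A by blast
  next
    case (step p)
    then obtain A' where A': "\<forall>j<d. A' j = A j" "disjoint_family_on A' {..<p}"
      "\<forall>j<p. A' j \<subseteq> X j \<and> card (A' j) = t" by auto
    let ?U = "\<Union>j<p. A' j"
    have finU: "finite ?U"
      using A'(3) \<open>0 < t\<close> by (auto intro: card_ge_0_finite)
    have "card ?U \<le> (\<Sum>j<p. card (A' j))" by (rule card_UN_le) auto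
    also have "\<dots> = p * t" using A'(3) by simp
    finally have U: "card ?U \<le> p * t" .
    have "t + p * t \<le> s * t"
      using mult_le_mono1[of "Suc p" s t] step.prems by simp
    then have "t \<le> card (X p) - card ?U"
      using U X[of p] step.prems by linarith
    also have "\<dots> \<le> card (X p - ?U)" by (rule diff_card_le_card_Diff[OF finU])
    finally obtain Y where Y: "Y \<subseteq> X p - ?U" "card Y = t"
      using obtain_subset_with_card_n by metis
    have "disjoint_family_on (A'(p := Y)) {..<Suc p}"
      using A'(2) Y(1) unfolding disjoint_family_on_def by (auto simp: less_Suc_eq) blast+
    moreover have "\<forall>j<Suc p. (A'(p := Y)) j \<subseteq> X j \<and> card ((A'(p := Y)) j) = t"
      using A'(3) Y by (auto simp: less_Suc_eq)
    moreover have "\<forall>j<d. (A'(p := Y)) j = A j" using A'(1) step.hyps by auto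
    ultimately show ?case by blast
  qed
  from this[OF d order_refl] show ?thesis using that by blast
qed

lemma card_dense_vertices:
  assumes "\<not> has_dense_pair V E b m \<theta>" "B \<subseteq> V" "card B = b"
  shows "card {w\<in>V - B. \<theta> * b \<le> card {y\<in>B. {w, y} \<in> E}} < m"
proof (rule ccontr)
  assume "\<not> ?thesis"
  then have "m \<le> card {w\<in>V - B. \<theta> * b \<le> card {y\<in>B. {w, y} \<in> E}}" by simp
  then obtain W where "W \<subseteq> {w\<in>V - B. \<theta> * b \<le> card {y\<in>B. {w, y} \<in> E}}" "card W = m"
    by (rule obtain_subset_with_card_n)
  then show False using assms unfolding has_dense_pair_def by blast
qed

text \<open>
  A clique of \<open>C\<close> without common neighbour outside the parts only has to be enlarged inside \<open>C\<close>, so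
  vertices of the parts themselves need no attention in \<open>free_transversals\<close>.
\<close>

lemma free_clique_extends:
  assumes V: "finite V" and "C \<subseteq> V" "\<And>j. j < s \<Longrightarrow> A j \<subseteq> C"
    and f: "f \<in> free_transversals V E s A" "[f ` {..<s}]\<^bsup>2\<^esup> \<subseteq> E"
  obtains K where "maximal_clique V E K" "K \<subseteq> C"
proof -
  define \<K> where "\<K> = {K. K \<subseteq> C \<and> clique K E \<and> f ` {..<s} \<subseteq> K}"
  have "finite \<K>" unfolding \<K>_def
    using finite_subset[OF \<open>C \<subseteq> V\<close> V] by simp
  moreover have "f ` {..<s} \<in> \<K>"
    using f assms(3) unfolding \<K>_def free_transversals_def clique_def by (auto simp: subset_iff)
  ultimately obtain K where K: "K \<in> \<K>" "\<And>K'. K' \<in> \<K> \<Longrightarrow> K \<subseteq> K' \<Longrightarrow> K = K'"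
    using finite_has_maximal[of \<K>] by blast
  have "maximal_clique V E K"
    unfolding maximal_clique_def
  proof (intro conjI allI impI)
    show "K \<subseteq> V" "clique K E" using K(1) \<open>C \<subseteq> V\<close> by (auto simp: \<K>_def)
    fix K' assume K': "K' \<subseteq> V \<and> clique K' E \<and> K \<subseteq> K'"
    have "x \<in> K" if "x \<in> K'" for x
    proof (cases "x \<in> C")
      case True
      have "insert x K \<in> \<K>"
      proof -
        have "insert x K \<subseteq> K'" using K' that by simp
        then have "clique (insert x K) E" using K' smaller_clique by blast
        then show ?thesis using K(1) True by (auto simp: \<K>_def)
      qed
      then show ?thesis using K(2) by blast
    next
      case False
      then have "x \<in> V - (\<Union>j<s. A j)" using K' that assms(3) by blast
      then obtain j where j: "j < s" "{x, f j} \<notin> E"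
        using f(1) unfolding free_transversals_def by blast
      have "f j \<in> K" using K(1) j by (auto simp: \<K>_def)
      moreover have "f j \<in> C" using K(1) j by (auto simp: \<K>_def)
      ultimately have "f j \<in> K'" "x \<noteq> f j" using K' False by auto
      moreover have "\<forall>v\<in>K'. \<forall>w\<in>K'. v \<noteq> w \<longrightarrow> {v, w} \<in> E"
        using K' unfolding clique_def by simp
      ultimately have "{x, f j} \<in> E" using that by simp
      then show ?thesis using j by simp
    qed
    then show "K' = K" using K' by blast
  qed
  then show ?thesis using that K(1) by (auto simp: \<K>_def)
qed

text \<open>
  A vertex \<open>w\<close> is adjacent to a fraction \<open>\<Prod>j. |N(w) \<inter> A j| / t\<close> of all transversals. By the AM-GM
  inequality this is at most \<open>\<theta>\<^sup>s\<close> unless \<open>w\<close> is one of at most \<open>m\<close> vertices; for these it is at most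
  \<open>\<eta>\<^sup>d\<close> by the first \<open>d\<close> parts, or zero by the hypothesis \<open>bad\<close>.
\<close>

lemma card_free_transversals:
  fixes \<theta> \<eta> :: real
  assumes V: "finite V" and AV: "\<And>j. j < s \<Longrightarrow> A j \<subseteq> V" and disj: "disjoint_family_on A {..<s}"
    and cA: "\<And>j. j < s \<Longrightarrow> card (A j) = t" and d: "d \<le> s" "0 < d" and \<eta>: "0 \<le> \<eta>" "0 \<le> \<theta>"
    and dense: "\<not> has_dense_pair V E (s * t) m \<theta>"
    and bad: "\<And>w. w \<in> V - (\<Union>j<s. A j) \<Longrightarrow> \<eta> * real (d * t) \<le> card {y\<in>\<Union>j<d. A j. {w, y} \<in> E}
        \<Longrightarrow> \<exists>j<s. \<forall>y\<in>A j. {w, y} \<notin> E"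
    and small: "card V * \<theta> ^ s + m * \<eta> ^ d \<le> 1/2"
  shows "t ^ s \<le> 2 * card (free_transversals V E s A)"
proof -
  let ?T = "PiE {..<s} A" and ?F = "free_transversals V E s A" and ?U = "\<Union>j<s. A j"
  define N where "N w j = {y\<in>A j. {w, y} \<in> E}" for w j
  have finA: "j < s \<Longrightarrow> finite (A j)" for j using AV V finite_subset by blast
  have finN: "j < s \<Longrightarrow> finite (N w j)" for w j using finA by (simp add: N_def)
  have cardN: "card {y\<in>\<Union>j<p. A j. {w, y} \<in> E} = (\<Sum>j<p. card (N w j))" if "p \<le> s" for w p
  proof -
    have "{y\<in>\<Union>j<p. A j. {w, y} \<in> E} = (\<Union>j<p. N w j)" by (auto simp: N_def)
    also have "card \<dots> = (\<Sum>j<p. card (N w j))"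
    proof (rule card_UN_disjoint)
      show "\<forall>i\<in>{..<p}. \<forall>j\<in>{..<p}. i \<noteq> j \<longrightarrow> N w i \<inter> N w j = {}"
        using disj that unfolding disjoint_family_on_def N_def by fastforce
    qed (use that finN in auto)
    finally show ?thesis .
  qed
  have cU: "card ?U = s * t"
    using disj finA cA by (subst card_UN_disjoint) (auto simp: disjoint_family_on_def)
  have UV: "?U \<subseteq> V" using AV by blast
  have finT: "finite ?T" using finA by (intro finite_PiE) auto
  define Dn where "Dn = {w\<in>V - ?U. \<theta> * real (s * t) \<le> card {y\<in>?U. {w, y} \<in> E}}"
  have cD: "card Dn \<le> m"
    unfolding Dn_def using card_dense_vertices[OF dense UV cU] by linarith
  have finD: "finite Dn" using V by (simp add: Dn_def)
  define P where "P w = (\<Prod>j<s. real (card (N w j)))" for w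
  have P0: "P w \<ge> 0" for w unfolding P_def by (intro prod_nonneg) auto
  have sparse: "P w \<le> (\<theta> * t) ^ s" if "w \<in> V - ?U - Dn" for w
    unfolding P_def
  proof (rule prod_le_mean_power)
    show "(\<Sum>j<s. real (card (N w j))) \<le> s * (\<theta> * t)"
    proof -
      have "\<not> \<theta> * real (s * t) \<le> card {y\<in>?U. {w, y} \<in> E}"
        using that unfolding Dn_def by blast
      then show ?thesis unfolding cardN[OF order_refl] by (simp add: mult_ac)
    qed
  qed auto
  have dens: "P w \<le> \<eta> ^ d * t ^ s" if "w \<in> Dn" for w
  proof (cases "\<eta> * real (d * t) \<le> card {y\<in>\<Union>j<d. A j. {w, y} \<in> E}")
    case True
    then obtain j where j: "j < s" "\<forall>y\<in>A j. {w, y} \<notin> E"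
      using bad[of w] \<open>w \<in> Dn\<close> by (auto simp: Dn_def)
    then have "N w j = {}" by (auto simp: N_def)
    then have "P w = 0" unfolding P_def using j by (intro prod_zero bexI[of _ j]) auto
    then show ?thesis using \<eta> by simp
  next
    case False
    have "P w = (\<Prod>j<d. real (card (N w j))) * (\<Prod>j\<in>{d..<s}. real (card (N w j)))"
      unfolding P_def using d by (metis prod.atLeastLessThan_concat lessThan_atLeast0 le0)
    also have "\<dots> \<le> (\<eta> * t) ^ d * (\<Prod>j\<in>{d..<s}. real t)"
    proof (intro mult_mono prod_le_mean_power prod_mono conjI)
      show "(\<Sum>j<d. real (card (N w j))) \<le> d * (\<eta> * t)"
        using False cardN[OF d(1), of w] by (simp add: mult_ac)
      fix j assume "j \<in> {d..<s}"
      then show "real (card (N w j)) \<le> real t"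
        using cA[of j] card_mono[OF finA, of j "N w j"] by (auto simp: N_def)
    qed (use \<eta> in \<open>auto intro!: prod_nonneg\<close>)
    also have "\<dots> = \<eta> ^ d * t ^ s"
      using d by (simp add: power_mult_distrib flip: power_add)
    finally show ?thesis .
  qed
  have "?T - ?F \<subseteq> (\<Union>w\<in>V - ?U. PiE {..<s} (N w))"
    unfolding free_transversals_def N_def by (auto simp: PiE_iff)
  then have "card (?T - ?F) \<le> card (\<Union>w\<in>V - ?U. PiE {..<s} (N w))"
    using V finN by (intro card_mono) (auto intro!: finite_PiE)
  also have "\<dots> \<le> (\<Sum>w\<in>V - ?U. card (PiE {..<s} (N w)))"
    using V by (intro card_UN_le) auto
  finally have "real (card (?T - ?F)) \<le> (\<Sum>w\<in>V - ?U. P w)"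
    by (simp add: P_def card_PiE of_nat_sum of_nat_prod flip: of_nat_le_iff[where 'a=real])
  also have "\<dots> = (\<Sum>w\<in>V - ?U - Dn. P w) + (\<Sum>w\<in>Dn. P w)"
    using V by (intro sum.subset_diff) (auto simp: Dn_def)
  also have "\<dots> \<le> card (V - ?U - Dn) * (\<theta> * t) ^ s + card Dn * (\<eta> ^ d * t ^ s)"
    by (intro add_mono sum_bounded_above sparse dens)
  also have "\<dots> \<le> card V * (\<theta> * t) ^ s + m * (\<eta> ^ d * t ^ s)"
    using cD V \<eta> by (intro add_mono mult_right_mono) (auto intro!: card_mono)
  also have "\<dots> = (card V * \<theta> ^ s + m * \<eta> ^ d) * t ^ s"
    by (simp add: power_mult_distrib algebra_simps)
  also have "\<dots> \<le> 1/2 * t ^ s" by (intro mult_right_mono small) auto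
  finally have half: "real (card (?T - ?F)) \<le> 1/2 * t ^ s" .
  have "?F \<subseteq> ?T" by (auto simp: free_transversals_def)
  then have "card ?T = card ?F + card (?T - ?F)"
    using finT card_Un_disjoint[of ?F "?T - ?F"] finite_subset[of ?F ?T] by (simp add: Un_absorb1)
  moreover have "card ?T = t ^ s" using cA by (simp add: card_PiE)
  ultimately have "real (t ^ s) = real (card ?F) + real (card (?T - ?F))" by simp
  with half have "real (t ^ s) \<le> real (2 * card ?F)" by simp
  then show ?thesis by (simp only: of_nat_le_iff)
qed

text \<open>
  Let \<open>v i\<close> minimise \<open>|C i - N(v i)|\<close>. The common non-neighbours of all \<open>v i\<close> are so many that some
  colour class \<open>C i\<close> contains \<open>s * t\<close> of them, and then every vertex has \<open>s * t\<close> non-neighbours in \<open>C i\<close>.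
  The first \<open>d\<close> parts are chosen arbitrarily in \<open>C i\<close>; each of the fewer than \<open>D\<close> vertices adjacent to nearly
  all of them gets a part of its own consisting of non-neighbours.
\<close>

lemma few_colors_impossible:
  fixes \<theta> \<eta> :: real
  assumes V: "finite V" "V \<noteq> {}" and col: "clique_coloring V E c"
    and k: "card (c ` V) \<le> k" "k \<le> card V"
    and s: "s = d + D" "0 < d" and t: "0 < t" and \<eta>: "0 \<le> \<eta>" "0 \<le> \<theta>"
    and bad: "\<not> has_bad_parts V E s t"
    and dense: "\<not> has_dense_pair V E (s * t) m \<theta>" "\<not> has_dense_pair V E (d * t) D \<eta>"
    and nonnb: "\<not> has_few_nonneighbours V E k (k * (s * t))"
    and small: "card V * \<theta> ^ s + m * \<eta> ^ d \<le> 1/2"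
  shows False
proof -
  define C where "C i = {x\<in>V. c x = i}" for i
  define M where "M w = {u. {u, w} \<notin> E}" for w
  have "\<exists>v. v \<in> V \<and> (\<forall>w. w \<in> V \<longrightarrow> card (C i \<inter> M v) \<le> card (C i \<inter> M w))" for i
    using V(2) ex_has_least_nat[of "\<lambda>v. v \<in> V" _ "\<lambda>v. card (C i \<inter> M v)"] by blast
  then obtain v where v: "\<And>i. v i \<in> V" "\<And>i w. w \<in> V \<Longrightarrow> card (C i \<inter> M (v i)) \<le> card (C i \<inter> M w)"
    by metis
  have "card (v ` c ` V) \<le> k"
    using card_image_le[of "c ` V" v] V k by simp
  moreover have "v ` c ` V \<subseteq> V" using v(1) by blast
  ultimately obtain W where W: "v ` c ` V \<subseteq> W" "W \<subseteq> V" "card W = k"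
    using exists_subset_between[of "v ` c ` V" k V] k V by blast
  define U where "U = {u\<in>V - W. \<forall>w\<in>W. {u, w} \<notin> E}"
  have cU: "k * (s * t) \<le> card U"
    using nonnb W(2,3) unfolding has_few_nonneighbours_def U_def not_le[symmetric] by blast
  have finU: "finite U" using V by (simp add: U_def)
  have "\<exists>i\<in>c ` V. s * t \<le> card (U \<inter> C i)"
  proof (rule ccontr)
    assume "\<not> (\<exists>i\<in>c ` V. s * t \<le> card (U \<inter> C i))"
    then have *: "card (U \<inter> C i) \<le> s * t - 1" if "i \<in> c ` V" for i
      using that by fastforce
    have "U = (\<Union>i\<in>c ` V. U \<inter> C i)" by (auto simp: U_def C_def)
    then have "card U \<le> (\<Sum>i\<in>c ` V. card (U \<inter> C i))"
      using card_UN_le[of "c ` V" "\<lambda>i. U \<inter> C i"] V by simp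
    also have "\<dots> \<le> card (c ` V) * (s * t - 1)"
      using sum_bounded_above[of "c ` V" "\<lambda>i. card (U \<inter> C i)" "s * t - 1"] * by simp
    also have "\<dots> \<le> k * (s * t - 1)" using k by simp
    also have "\<dots> < k * (s * t)"
    proof -
      have "0 < card (c ` V)" using V by (simp add: card_gt_0_iff)
      then show ?thesis using k s t by simp
    qed
    finally show False using cU by simp
  qed
  then obtain i where i: "i \<in> c ` V" "s * t \<le> card (U \<inter> C i)" by blast
  define C0 where "C0 = C i"
  have C0V: "C0 \<subseteq> V" by (auto simp: C0_def C_def)
  have finC0: "finite C0" using C0V V finite_subset by blast
  have CM: "s * t \<le> card (C0 \<inter> M w)" if "w \<in> V" for w
  proof -
    have "U \<inter> C i \<subseteq> C i \<inter> M (v i)"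
      using W(1) i(1) by (auto simp: U_def M_def)
    then have "card (U \<inter> C i) \<le> card (C i \<inter> M (v i))"
      using finC0 by (intro card_mono) (auto simp: C0_def)
    also have "\<dots> \<le> card (C i \<inter> M w)" by (rule v(2)[OF that])
    finally show ?thesis using i(2) by (simp add: C0_def)
  qed
  have cC0: "s * t \<le> card C0"
  proof -
    have "card (U \<inter> C i) \<le> card C0" using finC0 by (intro card_mono) (auto simp: C0_def)
    then show ?thesis using i(2) by simp
  qed
  have "d * t \<le> card C0" using cC0 s by (simp add: algebra_simps)
  then obtain A0 where A0: "disjoint_family_on A0 {..<d}"
      "\<And>j. j < d \<Longrightarrow> A0 j \<subseteq> C0 \<and> card (A0 j) = t"
    using extend_disjoint_parts[of d t "\<lambda>_. C0" undefined 0] t by (auto simp: disjoint_family_on_def)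
  define B where "B = (\<Union>j<d. A0 j)"
  have finA0: "j < d \<Longrightarrow> finite (A0 j)" for j using A0(2) finC0 finite_subset by blast
  have cB: "card B = d * t"
    unfolding B_def using A0 finA0 by (subst card_UN_disjoint) (auto simp: disjoint_family_on_def)
  have BV: "B \<subseteq> V" using A0(2) C0V unfolding B_def by blast
  define Wb where "Wb = {w\<in>V - B. \<eta> * real (d * t) \<le> card {y\<in>B. {w, y} \<in> E}}"
  have finWb: "finite Wb" using V by (simp add: Wb_def)
  have cWb: "card Wb < D" unfolding Wb_def by (rule card_dense_vertices[OF dense(2) BV cB])
  obtain e where e: "bij_betw e {0..<card Wb} Wb"
    using ex_bij_betw_nat_finite[OF finWb] by blast
  \<comment> \<open>Part \<open>d + j\<close> has to avoid the neighbourhood of the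
    \<open>j\<close>-th vertex of \<open>Wb\<close>. Since \<open>card Wb < D = s - d\<close> there
    are enough indices; the parts left over are again unrestricted in \<open>C0\<close>.\<close>
  define X where "X j = (if j < d \<or> card Wb \<le> j - d then C0 else C0 \<inter> M (e (j - d)))" for j
  have X: "s * t \<le> card (X j)" for j
  proof (cases "j < d \<or> card Wb \<le> j - d")
    case False
    then have "e (j - d) \<in> Wb" using bij_betwE[OF e] by auto
    then show ?thesis using False CM by (auto simp: X_def Wb_def)
  qed (simp add: X_def cC0)
  have XC: "X j \<subseteq> C0" for j by (auto simp: X_def)
  obtain A1 where A1: "\<And>j. j < d \<Longrightarrow> A1 j = A0 j" "disjoint_family_on A1 {..<s}"
      "\<And>j. j < s \<Longrightarrow> A1 j \<subseteq> X j \<and> card (A1 j) = t"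
    using extend_disjoint_parts[of s t X A0 d] X A0 t s by (auto simp: X_def)
  \<comment> \<open>The restriction makes the family extensional, as in
    \<open>has_bad_parts\<close>.\<close>
  define A where "A = restrict A1 {..<s}"
  have A: "\<And>j. j < s \<Longrightarrow> A j \<subseteq> X j" "\<And>j. j < s \<Longrightarrow> card (A j) = t" "\<And>j. j < d \<Longrightarrow> A j = A0 j"
    using A1 s by (auto simp: A_def)
  have disj: "disjoint_family_on A {..<s}"
    using A1(2) by (auto simp: A_def disjoint_family_on_def)
  have AC: "A j \<subseteq> C0" if "j < s" for j using A(1)[OF that] XC by blast
  have AB: "(\<Union>j<d. A j) = B" using A(3) by (auto simp: B_def)
  have "t ^ s \<le> 2 * card (free_transversals V E s A)"
  proof (rule card_free_transversals[OF V(1) _ disj _ _ s(2) \<eta> dense(1) _ small])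
    show "card (A j) = t" if "j < s" for j by (rule A(2)[OF that])
    show "d \<le> s" using s by simp
    show "A j \<subseteq> V" if "j < s" for j using AC[OF that] C0V by blast
    fix w assume w: "w \<in> V - (\<Union>j<s. A j)" "\<eta> * real (d * t) \<le> card {y\<in>\<Union>j<d. A j. {w, y} \<in> E}"
    have "B \<subseteq> (\<Union>j<s. A j)" using s unfolding AB[symmetric] by fastforce
    then have "w \<in> Wb" using w unfolding AB by (auto simp: Wb_def)
    then obtain j where j: "j < card Wb" "e j = w"
      using bij_betw_imp_surj_on[OF e] by (metis atLeastLessThan_iff imageE)
    then have "A (d + j) \<subseteq> M w" "d + j < s" using A(1)[of "d + j"] cWb s by (auto simp: X_def)
    then show "\<exists>j<s. \<forall>y\<in>A j. {w, y} \<notin> E" by (auto simp: M_def insert_commute)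
  qed
  moreover have "A \<in> PiE {..<s} (\<lambda>_. {B. B \<subseteq> V \<and> card B = t})"
    using AC C0V A(2) by (force simp: A_def)
  ultimately obtain f where "f \<in> free_transversals V E s A" "[f ` {..<s}]\<^bsup>2\<^esup> \<subseteq> E"
    using bad disj unfolding has_bad_parts_def by blast
  then obtain K where K: "maximal_clique V E K" "K \<subseteq> C0"
    using free_clique_extends[of V C0 s A f E] V(1) C0V AC by blast
  have "\<forall>x\<in>K. \<forall>y\<in>K. c x = c y"
    using K(2) by (auto simp: C0_def C_def subset_iff)
  then show False using col K(1) unfolding clique_coloring_def by simp
qed

section \<open>The colouring for the upper bound\<close>

text \<open>A colour \<open>z\<close> in \<open>{1..k}\<close> is given only to neighbours of
  \<open>z\<close>, so \<open>z\<close> extends every clique of that colour. \<open>dom\<close>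
  takes care of colour \<open>0\<close>, used on \<open>{1..k}\<close>, and \<open>rest\<close> of
  colour \<open>Suc k\<close>, used on the common non-neighbours.\<close>

lemma exists_clique_coloring:
  fixes E :: "nat set set"
  assumes "k < n" and dom: "\<exists>u\<in>{1..n} - {1..k}. \<forall>z\<in>{1..k}. {u, z} \<in> E"
    and rest: "\<And>K. K \<subseteq> {1..n} - {1..k} \<Longrightarrow> K \<noteq> {} \<Longrightarrow>
      \<not> ((\<forall>x\<in>K. \<forall>z\<in>{1..k}. {x, z} \<notin> E) \<and> clique K E
          \<and> (\<forall>u\<in>{1..n} - {1..k} - K. \<exists>x\<in>K. {u, x} \<notin> E))"
  shows "\<exists>c. clique_coloring {1..n} E c \<and> card (c ` {1..n}) \<le> k + 2"
proof -
  define Z where "Z = {1..k}"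
  define c where "c u = (if u \<in> Z then 0 else if \<exists>z\<in>Z. {u, z} \<in> E then SOME z. z \<in> Z \<and> {u, z} \<in> E
      else Suc k)" for u
  have cZ: "c u \<in> Z \<and> {u, c u} \<in> E" if "u \<notin> Z" "\<exists>z\<in>Z. {u, z} \<in> E" for u
    unfolding c_def using that someI_ex[of "\<lambda>z. z \<in> Z \<and> {u, z} \<in> E"] by auto
  have notZ: "0 \<notin> Z" "Suc k \<notin> Z" by (auto simp: Z_def)
  have range: "c u \<in> insert 0 (insert (Suc k) Z)" for u
  proof (cases "u \<notin> Z \<and> (\<exists>z\<in>Z. {u, z} \<in> E)")
    case True
    then show ?thesis using cZ by blast
  qed (auto simp: c_def)
  have "card (c ` {1..n}) \<le> card (insert 0 (insert (Suc k) Z))"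
    using range by (intro card_mono image_subsetI) (simp_all add: Z_def)
  also have "\<dots> \<le> k + 2" by (simp add: card_insert_if Z_def)
  finally have card: "card (c ` {1..n}) \<le> k + 2" .
  have extend: "False" if max: "maximal_clique {1..n} E K" and u: "u \<in> {1..n}" "u \<notin> K" "\<forall>x\<in>K. {u, x} \<in> E"
    for K u
  proof -
    have "clique (insert u K) E"
      using max u(3) unfolding maximal_clique_def clique_def by (auto simp: insert_commute)
    then show False using max u unfolding maximal_clique_def by blast
  qed
  have "clique_coloring {1..n} E c"
    unfolding clique_coloring_def
  proof (intro allI impI notI)
    fix K assume K: "maximal_clique {1..n} E K" and mono: "\<forall>x\<in>K. \<forall>y\<in>K. c x = c y"
    have KV: "K \<subseteq> {1..n}" and cl: "clique K E" using K by (auto simp: maximal_clique_def)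
    \<comment> \<open>The empty clique is not maximal, since \<open>k < n\<close> provides a vertex
      \<open>n\<close>.\<close>
    have "K \<noteq> {}" using extend[OF K, of n] \<open>k < n\<close> by auto
    then obtain y where y: "y \<in> K" by blast
    then have cy: "c x = c y" if "x \<in> K" for x using mono that by blast
    consider "c y = 0" | "c y = Suc k" | "c y \<in> Z" using range[of y] by auto
    then show False
    proof cases
      case 1
      have "K \<subseteq> Z"
      proof
        fix x assume "x \<in> K"
        then have "c x = 0" using cy 1 by simp
        then show "x \<in> Z" using cZ[of x] notZ by (cases "x \<in> Z"; cases "\<exists>z\<in>Z. {x, z} \<in> E") (auto simp: c_def)
      qed
      then show False using dom extend[OF K] unfolding Z_def by blast
    next
      case 2
      have free: "x \<notin> Z \<and> (\<forall>z\<in>Z. {x, z} \<notin> E)" if "x \<in> K" for x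
      proof -
        have cx: "c x = Suc k" using cy[OF that] 2 by simp
        then have "x \<notin> Z" by (auto simp: c_def)
        then show ?thesis using cZ[of x] cx notZ(2) by auto
      qed
      then have "K \<subseteq> {1..n} - {1..k}" using KV by (auto simp: Z_def)
      from rest[OF this \<open>K \<noteq> {}\<close>] obtain u where "u \<in> {1..n} - {1..k} - K" "\<forall>x\<in>K. {u, x} \<in> E"
        using free cl unfolding Z_def by blast
      then show False using extend[OF K, of u] by blast
    next
      case 3
      have nb: "x \<notin> Z \<and> {x, c y} \<in> E" if "x \<in> K" for x
        using cy[OF that] 3 cZ[of x] notZ
        by (cases "x \<in> Z"; cases "\<exists>z\<in>Z. {x, z} \<in> E") (auto simp: c_def)
      have "c y \<in> {1..n}" using 3 \<open>k < n\<close> by (auto simp: Z_def)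
      then show False using extend[OF K, of "c y"] nb 3 by (auto simp: insert_commute)
    qed
  qed
  then show ?thesis using card by blast
qed

section \<open>Failure probabilities\<close>

lemma prob_binomial_random_graph:
  "measure_pmf.prob (binomial_random_graph n (1/2)) {E. Q E} = avg ([{1..n}]\<^bsup>2\<^esup>) (\<lambda>E. of_bool (Q E))"
proof -
  let ?S = "[{1..n}]\<^bsup>2\<^esup>"
  have fin: "finite ?S" by (intro finite_imp_finite_nsets) simp
  have "binomial_random_graph n (1/2) = pmf_of_set (Pow ?S)"
    unfolding binomial_random_graph_def by (rule pmf_of_set_Pow_conv_bernoulli[OF fin])
  then have "measure_pmf.prob (binomial_random_graph n (1/2)) {E. Q E} = card (Pow ?S \<inter> {E. Q E}) / 2 ^ card ?S"
    using measure_pmf_of_set[of "Pow ?S" "{E. Q E}"] fin by (simp only: Pow_not_empty finite_Pow_iff card_Pow) simp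
  also have "\<dots> = avg ?S (\<lambda>E. of_bool (Q E))"
    unfolding avg_def using fin by (simp add: of_bool_def sum.If_cases)
  finally show ?thesis .
qed

text \<open>A union bound over the failures of \<open>dom\<close> and \<open>rest\<close> in
  \<open>exists_clique_coloring\<close>, the latter grouped by clique size. Counting subsets of all
  \<open>n\<close> vertices instead of the \<open>n - k\<close> available ones is a harmless
  overestimate.\<close>

lemma prob_no_coloring:
  assumes "k < n"
  shows "avg ([{1..n}]\<^bsup>2\<^esup>) (\<lambda>E. of_bool (\<not> (\<exists>c. clique_coloring {1..n} E c \<and> card (c ` {1..n}) \<le> k + 2)))
    \<le> (1 - (1/2) ^ k) ^ (n - k)
      + (\<Sum>s=1..n-k. (n choose s) * (1/2) ^ (s * k + (s choose 2)) * (1 - (1/2) ^ s) ^ (n - k - s))"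
proof -
  let ?V = "{1..n}" and ?Z = "{1..k}"
  define \<K> where "\<K> = {K. K \<subseteq> ?V - ?Z \<and> K \<noteq> {}}"
  define Q where "Q K E \<longleftrightarrow> (\<forall>x\<in>K. \<forall>z\<in>?Z. {x, z} \<notin> E) \<and> clique K E \<and> (\<forall>u\<in>?V - ?Z - K. \<exists>x\<in>K. {u, x} \<notin> E)" for K E
  define \<phi> where "\<phi> s = (1/2::real) ^ (s * k + (s choose 2)) * (1 - (1/2) ^ s) ^ (n - k - s)" for s
  have fin: "finite \<K>" unfolding \<K>_def by (rule finite_subset[of _ "Pow ?V"]) auto
  have "avg ([?V]\<^bsup>2\<^esup>) (\<lambda>E. of_bool (\<not> (\<exists>c. clique_coloring ?V E c \<and> card (c ` ?V) \<le> k + 2)))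
    \<le> avg ([?V]\<^bsup>2\<^esup>) (\<lambda>E. of_bool (\<forall>u\<in>?V - ?Z. \<exists>z\<in>?Z. {u, z} \<notin> E) + of_bool (\<exists>K\<in>\<K>. Q K E))"
  proof (rule avg_mono)
    fix E
    have "(\<forall>u\<in>?V - ?Z. \<exists>z\<in>?Z. {u, z} \<notin> E) \<or> (\<exists>K\<in>\<K>. Q K E)"
      if "\<not> (\<exists>c. clique_coloring ?V E c \<and> card (c ` ?V) \<le> k + 2)"
      using exists_clique_coloring[OF assms, of E] that unfolding \<K>_def Q_def by blast
    then show "(of_bool (\<not> (\<exists>c. clique_coloring ?V E c \<and> card (c ` ?V) \<le> k + 2)) :: real)
        \<le> of_bool (\<forall>u\<in>?V - ?Z. \<exists>z\<in>?Z. {u, z} \<notin> E) + of_bool (\<exists>K\<in>\<K>. Q K E)"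
      unfolding of_bool_def by auto
  qed
  also have "\<dots> = (1 - (1/2) ^ k) ^ (n - k) + avg ([?V]\<^bsup>2\<^esup>) (\<lambda>E. of_bool (\<exists>K\<in>\<K>. Q K E))"
    using prob_no_common_neighbour[of ?V ?Z "?V - ?Z"] assms
    by (simp add: avg_add card_Diff_subset)
  also have "avg ([?V]\<^bsup>2\<^esup>) (\<lambda>E. of_bool (\<exists>K\<in>\<K>. Q K E)) \<le> (\<Sum>K\<in>\<K>. avg ([?V]\<^bsup>2\<^esup>) (\<lambda>E. of_bool (Q K E)))"
    by (rule avg_union_bound[OF fin])
  also have "\<dots> = (\<Sum>K\<in>\<K>. \<phi> (card K))"
  proof (rule sum.cong[OF refl])
    fix K assume "K \<in> \<K>"
    then have "?Z \<subseteq> ?V" "K \<subseteq> ?V" "?Z \<inter> K = {}" using assms by (auto simp: \<K>_def)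
    from prob_isolated_maximal_clique[OF _ this]
    show "avg ([?V]\<^bsup>2\<^esup>) (\<lambda>E. of_bool (Q K E)) = \<phi> (card K)"
      unfolding Q_def \<phi>_def by simp
  qed
  also have "\<dots> = (\<Sum>s\<in>{1..n-k}. \<Sum>K\<in>{K\<in>\<K>. card K = s}. \<phi> (card K))"
  proof (rule sum.group[OF fin, symmetric])
    show "card ` \<K> \<subseteq> {1..n - k}"
    proof clarify
      fix K assume "K \<in> \<K>"
      then have K: "K \<subseteq> ?V - ?Z" "K \<noteq> {}" by (auto simp: \<K>_def)
      have "card K \<le> card (?V - ?Z)" using K by (intro card_mono) auto
      moreover have "card K > 0" using K finite_subset[OF K(1)] by (simp add: card_gt_0_iff)
      ultimately show "card K \<in> {1..n - k}" using assms by (simp add: card_Diff_subset)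
    qed
  qed simp
  also have "\<dots> \<le> (\<Sum>s\<in>{1..n-k}. (n choose s) * \<phi> s)"
  proof (rule sum_mono)
    fix s
    have \<phi>0: "\<phi> s \<ge> 0" unfolding \<phi>_def by (intro mult_nonneg_nonneg zero_le_power) (auto simp: power_le_one)
    have "card {K\<in>\<K>. card K = s} \<le> card {K. K \<subseteq> ?V \<and> card K = s}"
      by (intro card_mono) (auto simp: \<K>_def)
    also have "\<dots> = n choose s" by (simp add: n_subsets)
    finally have "real (card {K\<in>\<K>. card K = s}) \<le> real (n choose s)" by simp
    then have "real (card {K\<in>\<K>. card K = s}) * \<phi> s \<le> real (n choose s) * \<phi> s"
      using \<phi>0 by (rule mult_right_mono)
    then show "(\<Sum>K\<in>{K\<in>\<K>. card K = s}. \<phi> (card K)) \<le> (n choose s) * \<phi> s" by simp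
  qed
  finally show ?thesis by (simp add: \<phi>_def mult.assoc)
qed

lemma prob_few_colors:
  fixes \<theta> \<eta> x y :: real
  assumes n: "0 < n" "k \<le> n" and s: "s = d + D" "s = 2 * h" "0 < d" and t: "s * 2 ^ (h + 2) \<le> t"
    and \<eta>: "0 \<le> \<eta>" "0 \<le> \<theta>" and xy: "1 \<le> x" "1 \<le> y"
    and small: "n * \<theta> ^ s + m * \<eta> ^ d \<le> 1/2"
  shows "avg ([{1..n}]\<^bsup>2\<^esup>) (\<lambda>E. of_bool (\<exists>c. clique_coloring {1..n} E c \<and> card (c ` {1..n}) \<le> k))
    \<le> real n ^ (t * s) * exp (- (2 ^ s / 3))
      + real ((n choose (s * t)) * (n choose m)) * (((1 + x) / 2) / x powr \<theta>) ^ (s * t * m)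
      + real ((n choose (d * t)) * (n choose D)) * (((1 + y) / 2) / y powr \<eta>) ^ (d * t * D)
      + real (n choose k) * (2 ^ (k * (s * t)) * exp (- (real (n - k) / 2 ^ (k + 1))))"
proof -
  let ?V = "{1..n}"
  have "0 < s" "0 < s * 2 ^ (h + 2)" using s by auto
  then have t0: "0 < t" using t by linarith
  have "avg ([?V]\<^bsup>2\<^esup>) (\<lambda>E. of_bool (\<exists>c. clique_coloring ?V E c \<and> card (c ` ?V) \<le> k))
    \<le> avg ([?V]\<^bsup>2\<^esup>) (\<lambda>E. of_bool (has_bad_parts ?V E s t) + of_bool (has_dense_pair ?V E (s * t) m \<theta>)
        + of_bool (has_dense_pair ?V E (d * t) D \<eta>) + of_bool (has_few_nonneighbours ?V E k (k * (s * t))))"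
  proof (rule avg_mono)
    fix E
    have "has_bad_parts ?V E s t \<or> has_dense_pair ?V E (s * t) m \<theta>
        \<or> has_dense_pair ?V E (d * t) D \<eta> \<or> has_few_nonneighbours ?V E k (k * (s * t))"
      if "clique_coloring ?V E c" "card (c ` ?V) \<le> k" for c
      using few_colors_impossible[of ?V E c k s d D t \<eta> \<theta> m] that n s \<eta> small t0 by auto
    then show "(of_bool (\<exists>c. clique_coloring ?V E c \<and> card (c ` ?V) \<le> k) :: real)
      \<le> of_bool (has_bad_parts ?V E s t) + of_bool (has_dense_pair ?V E (s * t) m \<theta>)
        + of_bool (has_dense_pair ?V E (d * t) D \<eta>) + of_bool (has_few_nonneighbours ?V E k (k * (s * t)))"
      unfolding of_bool_def by auto
  qed
  also have "\<dots> \<le> real (card ?V) ^ (t * s) * exp (- (2 ^ s / 3))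
      + real ((card ?V choose (s * t)) * (card ?V choose m)) * (((1 + x) / 2) / x powr \<theta>) ^ (s * t * m)
      + real ((card ?V choose (d * t)) * (card ?V choose D)) * (((1 + y) / 2) / y powr \<eta>) ^ (d * t * D)
      + real (card ?V choose k) * (2 ^ (k * (s * t)) * exp (- (real (card ?V - k) / 2 ^ (k + 1))))"
    unfolding avg_add using \<open>0 < s\<close> s t xy
    by (intro add_mono prob_has_bad_parts prob_has_dense_pair prob_has_few_nonneighbours) auto
  finally show ?thesis by simp
qed

section \<open>Asymptotics\<close>

text \<open>A single term of the exponential series at \<open>s\<close>; it takes the place of
  Stirling's formula.\<close>

lemma power_le_exp_fact: "real s ^ s \<le> exp s * fact s"
proof -
  have "(\<Sum>i\<in>{s}. real s ^ i /\<^sub>R fact i) \<le> (\<Sum>i. real s ^ i /\<^sub>R fact i)"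
    by (intro sum_le_suminf summable_exp_generic) auto
  then show ?thesis by (simp add: exp_def field_simps)
qed

lemma choose_le_power_div_fact: "real (n choose s) \<le> real n ^ s / fact s"
proof -
  have "real ((n choose s) * fact s) \<le> real (n ^ s)"
    using binomial_fact_pow[of n s] by (simp only: of_nat_le_iff)
  then show ?thesis by (simp add: field_simps)
qed

lemma choose_le_power: "real (n choose s) \<le> real n ^ s"
proof -
  have "real n ^ s / fact s \<le> real n ^ s / 1"
    by (intro divide_left_mono) auto
  then show ?thesis using choose_le_power_div_fact[of n s] by linarith
qed

lemma one_minus_power_le_exp:
  fixes x :: real
  assumes "x \<le> 1"
  shows "(1 - x) ^ m \<le> exp (- (m * x))"
proof -
  have "(1 - x) ^ m \<le> exp (- x) ^ m"
    using assms exp_ge_add_one_self[of "- x"] by (intro power_mono) auto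
  then show ?thesis by (simp flip: exp_of_nat_mult)
qed

section \<open>Upper bound: the first-moment sum and its limit\<close>

text \<open>
  With \<open>y = n / 2\<^sup>s\<close> and \<open>l = ln n\<close>: for \<open>y \<ge> l\<^sup>1\<^sup>+\<^sup>\<delta>\<close> the factor \<open>exp (- y / 2)\<close> coming from the missing common neighbour
  wins, for smaller \<open>y\<close> the expected number of cliques of size \<open>s\<close> is already small.
\<close>

lemma term_bound:
  fixes l y \<delta> c :: real and n k s :: nat
  assumes n: "0 < n" and l: "l = ln n" "1 \<le> l" and \<delta>: "0 < \<delta>" "\<delta> < 1/2"
    and y: "y = n / 2 ^ s" and M: "n / 2 ^ k \<le> 8 * sqrt n * l powr (1/2 - \<delta>)"
    and k: "k \<le> n / 4" and ln4: "2 * l \<le> n / 4"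
    and E1: "32 + 12 * ln l \<le> l powr \<delta>" and E2: "80 * exp 4 \<le> l powr (\<delta> / 2)" and E3: "l powr (1 + \<delta>) \<le> sqrt n"
  shows "(n choose s) * (1/2) ^ (s * k + (s choose 2)) * (1 - (1/2) ^ s) ^ (n - k - s) \<le> exp (- (2 * l))"
proof -
  have y0: "y > 0" using n y by simp
  have sqrt2: "sqrt 2 \<le> 3 / 2" by (rule real_le_lsqrt) (auto simp: power2_eq_square)
  have base: "(n / 2 ^ k * sqrt (2 / 2 ^ s)) \<le> 8 * sqrt 2 * l powr (1/2 - \<delta>) * sqrt y"
  proof -
    have "n / 2 ^ k * sqrt (2 / 2 ^ s) \<le> 8 * sqrt n * l powr (1/2 - \<delta>) * sqrt (2 / 2 ^ s)"
      using M by (intro mult_right_mono) auto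
    also have "\<dots> = 8 * l powr (1/2 - \<delta>) * (sqrt n * sqrt (2 / 2 ^ s))" by simp
    also have "sqrt n * sqrt (2 / 2 ^ s) = sqrt 2 * sqrt y"
      unfolding y by (simp add: real_sqrt_divide real_sqrt_mult)
    finally show ?thesis by (simp add: mult_ac)
  qed
  \<comment> \<open>Written as an \<open>s\<close>-th power, this weight combines with the others to
    \<open>(n / 2 ^ k * sqrt (2 / 2 ^ s)) ^ s / fact s\<close>.\<close>
  have half: "(1/2) ^ (s choose 2) = sqrt (2 / 2 ^ s) ^ s"
  proof (rule power2_eq_imp_eq)
    have "((1/2) ^ (s choose 2))\<^sup>2 = (1/2::real) ^ (2 * (s choose 2))"
      by (simp add: power_mult[symmetric] mult.commute)
    also have "2 * (s choose 2) = s * (s - 1)"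
      unfolding choose_two by (intro dvd_mult_div_cancel) (cases "even s"; simp)
    also have "(1/2::real) ^ (s * (s - 1)) = ((1/2) ^ (s - 1)) ^ s"
      by (simp add: power_mult[symmetric] mult.commute)
    also have "\<dots> = (2 / 2 ^ s) ^ s"
      by (cases s) (auto simp: power_divide)
    also have "\<dots> = (sqrt (2 / 2 ^ s) ^ s)\<^sup>2"
      unfolding power_mult[symmetric] mult.commute[of s 2] unfolding power_mult by simp
    finally show "((1/2) ^ (s choose 2))\<^sup>2 = (sqrt (2 / 2 ^ s) ^ s)\<^sup>2" .
  qed auto
  let ?q = "(1 - (1/2) ^ s :: real) ^ (n - k - s)"
  have q: "0 \<le> ?q" "?q \<le> 1" by (auto intro!: zero_le_power power_le_one simp: power_le_one)
  have "(n choose s) * (1/2) ^ (s * k + (s choose 2)) * ?q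
      \<le> (real n ^ s / fact s) * (1/2) ^ (s * k + (s choose 2)) * ?q"
    using q by (intro mult_right_mono choose_le_power_div_fact) auto
  also have "\<dots> = (n / 2 ^ k * sqrt (2 / 2 ^ s)) ^ s / fact s * ?q"
    unfolding power_add half by (simp add: power_mult_distrib power_divide mult.commute flip: power_mult)
  also have "\<dots> \<le> (8 * sqrt 2 * l powr (1/2 - \<delta>) * sqrt y) ^ s / fact s * ?q"
    using base q by (intro mult_right_mono divide_right_mono power_mono) auto
  finally have main: "(n choose s) * (1/2) ^ (s * k + (s choose 2)) * ?q
      \<le> (8 * sqrt 2 * l powr (1/2 - \<delta>) * sqrt y) ^ s / fact s * ?q" .
  show ?thesis
  proof (cases "l powr (1 + \<delta>) \<le> y")
    case True
    have l1: "1 \<le> l powr (1 + \<delta>)" using l \<delta> by (intro ge_one_powr_ge_zero) auto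
    then have y1: "1 \<le> y" using True by linarith
    have s2: "s \<le> 2 * l"
    proof -
      have "2 ^ s \<le> real n" using y1 by (simp add: y)
      then have "ln (2 ^ s) \<le> l" unfolding l by (intro ln_mono) auto
      then have "s * ln 2 \<le> l" by (simp add: ln_realpow)
      moreover have "s * (1/2) \<le> s * ln 2"
        using ln2_ge_two_thirds by (intro mult_left_mono) auto
      ultimately show ?thesis by simp
    qed
    define B where "B = 3 + 1/2 * ln l + 1/2 * ln y"
    have l0: "0 \<le> ln l" "0 \<le> ln y" using l y1 by auto
    have "8 * sqrt 2 * l powr (1/2 - \<delta>) * sqrt y \<le> exp 3 * l powr (1/2) * sqrt y"
    proof (intro mult_mono)
      have "8 * sqrt 2 \<le> 12" using sqrt2 by simp
      also have "(12::real) \<le> exp 3"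
        using exp_lower_Taylor_quadratic[of 1] power_mono[of "5/2" "exp 1::real" 3]
        by (simp add: power_divide flip: exp_of_nat_mult)
      finally show "8 * sqrt 2 \<le> exp (3::real)" .
    qed (use l \<delta> y0 in \<open>auto intro: powr_mono\<close>)
    also have "\<dots> = exp B"
      using l y0 unfolding B_def exp_add by (simp add: powr_def powr_half_sqrt[symmetric])
    finally have "(8 * sqrt 2 * l powr (1/2 - \<delta>) * sqrt y) ^ s \<le> exp B ^ s"
      using y0 by (intro power_mono) auto
    also have "\<dots> = exp (s * B)" by (simp add: exp_of_nat_mult)
    also have "\<dots> \<le> exp (2 * l * B)"
      using s2 l0 by (intro exp_le_cancel_iff[THEN iffD2] mult_right_mono) (auto simp: B_def)
    finally have 1: "(8 * sqrt 2 * l powr (1/2 - \<delta>) * sqrt y) ^ s \<le> exp (2 * l * B)" .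
    have 2: "?q \<le> exp (- (y / 2))"
    proof -
      have "?q \<le> exp (- ((n - k - s) * (1/2) ^ s))"
        by (rule one_minus_power_le_exp) (auto simp: power_le_one)
      also have "\<dots> \<le> exp (- (y / 2))"
      proof -
        have "real n / 2 \<le> real (n - k - s)" using k s2 ln4 by linarith
        then have "real n / 2 * (1/2) ^ s \<le> (n - k - s) * (1/2) ^ s" by (intro mult_right_mono) auto
        then show ?thesis by (simp add: y power_divide)
      qed
      finally show ?thesis .
    qed
    have "(8 * sqrt 2 * l powr (1/2 - \<delta>) * sqrt y) ^ s / fact s \<le> exp (2 * l * B) / 1"
      using 1 by (intro frac_le) auto
    then have "(8 * sqrt 2 * l powr (1/2 - \<delta>) * sqrt y) ^ s / fact s * ?q \<le> exp (2 * l * B) * exp (- (y / 2))"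
      using 2 q by (intro mult_mono) auto
    also have "\<dots> = exp (2 * l * B - y / 2)" by (simp flip: exp_add)
    also have "\<dots> \<le> exp (- (2 * l))"
    proof (intro exp_le_cancel_iff[THEN iffD2])
      \<comment> \<open>The tangent of the logarithm at \<open>?Y\<close> bounds
        \<open>l * ln y\<close> by \<open>2 * (l * ln l)\<close> plus
        \<open>y / l powr \<delta>\<close>, a small fraction of \<open>y\<close>.\<close>
      let ?Y = "l powr (1 + \<delta>)"
      have Y0: "?Y > 0" using l by simp
      have "ln (y / ?Y) \<le> y / ?Y - 1" using y0 Y0 by (intro ln_le_minus_one) auto
      then have "ln y \<le> (1 + \<delta>) * ln l + y / ?Y"
        using y0 l by (simp add: ln_div ln_powr)
      also have "\<dots> \<le> 2 * ln l + y / ?Y" using l0 \<delta> by (intro add_mono mult_right_mono) auto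
      finally have "l * ln y \<le> l * (2 * ln l + y / ?Y)" using l by (intro mult_left_mono) auto
      also have "\<dots> = 2 * (l * ln l) + y / l powr \<delta>"
        using l by (simp add: powr_add field_simps)
      also have "y / l powr \<delta> \<le> y / 4"
        using E1 l0 y0 by (intro divide_left_mono) auto
      finally have a: "l * ln y \<le> 2 * (l * ln l) + y / 4" by simp
      have "l * (32 + 12 * ln l) \<le> l * l powr \<delta>" using E1 l by (intro mult_left_mono) auto
      also have "\<dots> \<le> y" using True l by (simp add: powr_add)
      finally have b: "32 * l + 12 * (l * ln l) \<le> y" by (simp add: algebra_simps)
      have "2 * l * B = 6 * l + l * ln l + l * ln y" by (simp add: B_def algebra_simps)
      then show "2 * l * B - y / 2 \<le> - (2 * l)" using a b by linarith
    qed
    finally show ?thesis using main by linarith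
  next
    case False
    \<comment> \<open>Small \<open>y\<close> means \<open>2 ^ s > sqrt n\<close>; so
      \<open>s\<close> is at least of order \<open>l\<close>, and dividing by \<open>fact s\<close>
      gains enough.\<close>
    have sl: "l / 2 \<le> s"
    proof -
      have "n < 2 ^ s * l powr (1 + \<delta>)" using False by (simp add: y field_simps)
      also have "\<dots> \<le> 2 ^ s * sqrt n" using E3 by (intro mult_left_mono) auto
      finally have "sqrt n * sqrt n < 2 ^ s * sqrt n" by simp
      then have "sqrt n < 2 ^ s" by (rule mult_right_less_imp_less) simp
      then have "ln (sqrt n) \<le> ln (2 ^ s)" using n by (intro ln_mono) auto
      then have "l / 2 \<le> s * ln 2" using n by (simp add: l ln_sqrt ln_realpow)
      also have "\<dots> \<le> real s * 1" using ln_2_less_1 by (intro mult_left_mono) auto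
      finally show ?thesis by simp
    qed
    have s0: "s > 0" using sl l by (cases s) auto
    \<comment> \<open>The factor \<open>exp (-5)\<close> pays for the \<open>exp s\<close> lost in
      \<open>s ^ s / fact s\<close> and leaves
      \<open>exp (- (4 * s)) \<le> exp (- (2 * l))\<close>.\<close>
    have "8 * sqrt 2 * l powr (1/2 - \<delta>) * sqrt y \<le> s * exp (-5)"
    proof -
      have "sqrt y \<le> sqrt (l powr (1 + \<delta>))" using False by simp
      also have "\<dots> = l powr ((1 + \<delta>) / 2)" using l by (simp add: powr_half_sqrt[symmetric] powr_powr)
      finally have "8 * sqrt 2 * l powr (1/2 - \<delta>) * sqrt y \<le> 8 * sqrt 2 * l powr (1/2 - \<delta>) * l powr ((1 + \<delta>) / 2)"
        by (intro mult_left_mono) auto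
      also have "\<dots> = 8 * sqrt 2 * (l / l powr (\<delta> / 2))"
      proof -
        have "l powr (1/2 - \<delta>) * l powr ((1 + \<delta>) / 2) * l powr (\<delta> / 2) = l powr 1"
          unfolding powr_add[symmetric] by (rule arg_cong) (simp add: field_simps)
        then show ?thesis using l by (simp add: field_simps)
      qed
      also have "\<dots> \<le> 12 * (l / (80 * exp 4))"
        using E2 l sqrt2 by (intro mult_mono divide_left_mono) auto
      also have "\<dots> = l / 2 * (24 / 80 * exp (-4))" by (simp add: exp_minus field_simps)
      also have "\<dots> \<le> s * (24 / 80 * exp (-4))" using sl by (intro mult_right_mono) auto
      also have "\<dots> \<le> s * exp (-5)"
      proof (intro mult_left_mono)
        have "exp (-4) = exp 1 * exp (-5::real)" by (simp flip: exp_add)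
        then show "24 / 80 * exp (-4) \<le> exp (-5::real)" using exp_le by simp
      qed auto
      finally show ?thesis .
    qed
    then have "(8 * sqrt 2 * l powr (1/2 - \<delta>) * sqrt y) ^ s / fact s \<le> (s * exp (-5)) ^ s / fact s"
      using y0 by (intro divide_right_mono power_mono) auto
    also have "\<dots> = (s ^ s / fact s) * exp (- (5 * s))"
      by (simp add: power_mult_distrib flip: exp_of_nat_mult)
    also have "\<dots> \<le> exp s * exp (- (5 * s))"
      using power_le_exp_fact[of s] by (intro mult_right_mono) (auto simp: field_simps)
    also have "\<dots> = exp (- (4 * s))" by (simp flip: exp_add)
    also have "\<dots> \<le> exp (- (2 * l))" using sl by simp
    finally have "(8 * sqrt 2 * l powr (1/2 - \<delta>) * sqrt y) ^ s / fact s * ?q \<le> exp (- (2 * l)) * 1"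
      using q by (intro mult_mono) auto
    then show ?thesis using main by linarith
  qed
qed

lemma powr_log_ln:
  fixes n :: nat and a b :: real
  assumes "1 < ln (real n)"
  shows "2 powr (1/2 * log 2 n - a * log 2 (ln n)) = sqrt n / ln n powr a"
proof -
  have n: "0 < n" using assms by (cases n) auto
  have "2 powr (1/2 * log 2 n) = n powr (1/2)"
  proof -
    have "2 powr (1/2 * log 2 n) = (2 powr log 2 n) powr (1/2)"
      unfolding powr_powr by (simp only: mult.commute)
    then show ?thesis using n by simp
  qed
  moreover have "2 powr (a * log 2 (ln n)) = ln n powr a"
    using assms by (simp add: powr_powr[symmetric] mult.commute[of a])
  ultimately show ?thesis using n by (simp add: powr_diff powr_half_sqrt)
qed

lemma upper_tendsto:
  fixes \<delta> :: real
  assumes \<delta>: "0 < \<delta>" "\<delta> < 1/2"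
  shows "(\<lambda>n::nat. avg ([{1..n}]\<^bsup>2\<^esup>) (\<lambda>E. of_bool (\<not> (\<exists>c. clique_coloring {1..n} E c
      \<and> real (card (c ` {1..n})) \<le> 1/2 * log 2 (real n) - (1/2 - \<delta>) * log 2 (ln (real n)))))) \<longlonglongrightarrow> 0"
    (is "(\<lambda>n. ?P n) \<longlonglongrightarrow> 0")
proof (rule tendsto_sandwich[OF _ _ tendsto_const])
  show "\<forall>\<^sub>F n in sequentially. 0 \<le> ?P n" by (intro always_eventually allI avg_nonneg) auto
  \<comment> \<open>The first summand bounds the probability that \<open>{1..k}\<close> has no
    common neighbour, the second is \<open>n\<close> times the bound of
    \<open>term_bound\<close>.\<close>
  show "(\<lambda>n. exp (- (sqrt (real n) / 2)) + 1 / real n) \<longlonglongrightarrow> 0" by real_asymp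
  define \<kappa> where "\<kappa> n = 1/2 * log 2 (real n) - (1/2 - \<delta>) * log 2 (ln (real n))" for n
  have "\<forall>\<^sub>F n in sequentially. 2 \<le> \<kappa> n" unfolding \<kappa>_def using \<delta> by real_asymp
  moreover have "\<forall>\<^sub>F n in sequentially. 1 < ln (real n)" by real_asymp
  moreover have "\<forall>\<^sub>F n in sequentially. 2 * ln (real n) \<le> real n / 4" by real_asymp
  moreover have "\<forall>\<^sub>F n in sequentially. 32 + 12 * ln (ln (real n)) \<le> ln (real n) powr \<delta>" using \<delta> by real_asymp
  moreover have "\<forall>\<^sub>F n in sequentially. 80 * exp 4 \<le> ln (real n) powr (\<delta> / 2)" using \<delta> by real_asymp
  moreover have "\<forall>\<^sub>F n in sequentially. ln (real n) powr (1 + \<delta>) \<le> sqrt (real n)" using \<delta> by real_asymp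
  moreover have "\<forall>\<^sub>F n in sequentially. 16 \<le> (n::nat)" by (rule eventually_ge_at_top)
  ultimately show "\<forall>\<^sub>F n in sequentially. ?P n \<le> exp (- (sqrt (real n) / 2)) + 1 / real n"
  proof eventually_elim
    case (elim n)
    \<comment> \<open>The two additional colours are subtracted here. With the rounding this gives
      \<open>k \<ge> \<kappa> n - 3\<close>, whence the factor 8 in \<open>M\<close>.\<close>
    define k where "k = nat \<lfloor>\<kappa> n\<rfloor> - 2"
    have n0: "0 < n" using elim by simp
    have "2 \<le> \<lfloor>\<kappa> n\<rfloor>" using elim(1) by (simp add: le_floor_iff)
    then have "real k = real_of_int \<lfloor>\<kappa> n\<rfloor> - 2"
      unfolding k_def by (subst of_nat_diff) (simp_all add: le_nat_iff)
    then have k: "real k \<le> \<kappa> n - 2" "\<kappa> n - 3 \<le> real k"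
      by linarith+
    have l0: "0 < ln (real n)" "0 \<le> log 2 (ln (real n))" using elim(2) by auto
    have "2 ^ k = 2 powr real k" by (simp add: powr_realpow)
    also have "\<dots> \<le> 2 powr (1/2 * log 2 n)"
    proof (intro powr_mono)
      have "0 \<le> (1/2 - \<delta>) * log 2 (ln (real n))"
        using l0(2) \<delta> by (intro mult_nonneg_nonneg) auto
      then show "real k \<le> 1/2 * log 2 n" using k(1) unfolding \<kappa>_def by linarith
    qed simp
    also have "\<dots> = sqrt n"
      using powr_log_ln[OF elim(2), of 0] l0 by simp
    finally have k2: "2 ^ k \<le> sqrt n" .
    have "16 * n \<le> n * n" using elim by simp
    then have "4 * sqrt n \<le> n"
      using real_sqrt_le_mono[of "16 * n" "n * n"] by (simp add: real_sqrt_mult flip: of_nat_le_iff[where 'a=real])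
    moreover have "real k \<le> 2 ^ k" using of_nat_less_two_power[of k] by (simp add: less_imp_le)
    ultimately have kn: "k \<le> n / 4" using k2 by linarith
    have M: "n / 2 ^ k \<le> 8 * sqrt n * ln n powr (1/2 - \<delta>)"
    proof -
      have "sqrt n / ln n powr (1/2 - \<delta>) = 2 powr (\<kappa> n)"
        unfolding \<kappa>_def by (rule powr_log_ln[OF elim(2), symmetric])
      also have "\<dots> \<le> 2 powr (real k + 3)" using k(2) by (intro powr_mono) auto
      also have "\<dots> = 8 * 2 ^ k" by (simp add: powr_add powr_realpow)
      finally have "sqrt n * (sqrt n / ln n powr (1/2 - \<delta>)) \<le> sqrt n * (8 * 2 ^ k)" by (intro mult_left_mono) auto
      then have "n / ln n powr (1/2 - \<delta>) \<le> sqrt n * (8 * 2 ^ k)" by simp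
      then show ?thesis using l0 by (simp add: field_simps)
    qed
    have "?P n \<le> avg ([{1..n}]\<^bsup>2\<^esup>) (\<lambda>E. of_bool (\<not> (\<exists>c. clique_coloring {1..n} E c \<and> card (c ` {1..n}) \<le> k + 2)))"
    proof (rule avg_mono)
      fix E
      have "real (card (c ` {1..n})) \<le> \<kappa> n" if "card (c ` {1..n}) \<le> k + 2" for c :: "nat \<Rightarrow> nat"
        using that k(1) by linarith
      then show "(of_bool (\<not> (\<exists>c. clique_coloring {1..n} E c \<and> real (card (c ` {1..n})) \<le> 1/2 * log 2 (real n) - (1/2 - \<delta>) * log 2 (ln (real n)))) :: real)
        \<le> of_bool (\<not> (\<exists>c. clique_coloring {1..n} E c \<and> card (c ` {1..n}) \<le> k + 2))"
        unfolding of_bool_def \<kappa>_def by auto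
    qed
    also have "\<dots> \<le> (1 - (1/2) ^ k) ^ (n - k)
      + (\<Sum>s=1..n-k. (n choose s) * (1/2) ^ (s * k + (s choose 2)) * (1 - (1/2) ^ s) ^ (n - k - s))"
      using kn n0 by (intro prob_no_coloring) linarith
    also have "\<dots> \<le> exp (- (sqrt (real n) / 2)) + real n * exp (- (2 * ln n))"
    proof (rule add_mono)
      have "(1 - (1/2) ^ k) ^ (n - k) \<le> exp (- (real (n - k) * (1/2) ^ k))"
        by (rule one_minus_power_le_exp) (auto simp: power_le_one)
      also have "\<dots> \<le> exp (- (sqrt n / 2))"
      proof -
        have "sqrt n / 2 = (n / 2) * (1 / sqrt n)" using n0 by (simp add: field_simps)
        also have "\<dots> \<le> real (n - k) * (1/2) ^ k"
          using kn k2 n0 by (intro mult_mono) (auto simp: power_divide of_nat_diff intro!: divide_left_mono)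
        finally show ?thesis by simp
      qed
      finally show "(1 - (1/2) ^ k) ^ (n - k) \<le> exp (- (sqrt (real n) / 2))" .
      have "(\<Sum>s=1..n-k. (n choose s) * (1/2) ^ (s * k + (s choose 2)) * (1 - (1/2) ^ s) ^ (n - k - s))
          \<le> real (card {1..n-k}) * exp (- (2 * ln n))"
        by (intro sum_bounded_above term_bound[OF n0 refl _ \<delta> refl M kn]) (use elim in auto)
      also have "\<dots> \<le> real n * exp (- (2 * ln n))" by (intro mult_right_mono) auto
      finally show "(\<Sum>s=1..n-k. (n choose s) * (1/2) ^ (s * k + (s choose 2)) * (1 - (1/2) ^ s) ^ (n - k - s))
          \<le> real n * exp (- (2 * ln n))" .
    qed
    also have "real n * exp (- (2 * ln n)) = 1 / n"
    proof -
      have "exp (2 * ln (real n)) = real n * real n"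
        using n0 by (simp add: exp_double power2_eq_square)
      then show ?thesis using n0 by (simp add: exp_minus field_simps)
    qed
    finally show ?case .
  qed
qed

section \<open>Lower bound: choice of parameters and limit\<close>

text \<open>The Chernoff factor for the threshold \<open>1/2 + \<epsilon>\<close> at
  \<open>x = 1 + 2 * \<epsilon>\<close>. Only the order \<open>\<epsilon>\<^sup>2\<close> of the
  exponent matters: for \<open>\<epsilon> = 1/s\<close> and \<open>m = s ^ 4\<close>, the power
  \<open>s * t * m\<close> of the factor is at most \<open>exp (- (s ^ 3 * t / 2))\<close>, against
  at most \<open>exp (s\<^sup>2 * t)\<close> choices of the set \<open>B\<close>.\<close>

lemma bias_factor_le:
  fixes \<epsilon> :: real
  assumes "0 < \<epsilon>" "\<epsilon> \<le> 1/2"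
  shows "((1 + (1 + 2 * \<epsilon>)) / 2) / (1 + 2 * \<epsilon>) powr (1/2 + \<epsilon>) \<le> exp (- (\<epsilon>\<^sup>2 / 2))"
proof -
  have pos: "0 < 1 + \<epsilon>" "0 < 1 + 2 * \<epsilon>" using assms by auto
  define L where "L = ln (1 + 2 * \<epsilon>)"
  have "(1 + \<epsilon>)\<^sup>2 \<le> (1 + 2 * \<epsilon>) * (1 + \<epsilon>\<^sup>2)"
    using assms by (simp add: power2_eq_square algebra_simps)
  also have "\<dots> \<le> (1 + 2 * \<epsilon>) * exp (\<epsilon>\<^sup>2)"
    using pos exp_ge_add_one_self[of "\<epsilon>\<^sup>2"] by (intro mult_left_mono) auto
  finally have "ln ((1 + \<epsilon>)\<^sup>2) \<le> ln ((1 + 2 * \<epsilon>) * exp (\<epsilon>\<^sup>2))"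
    using pos by (intro ln_mono) auto
  then have 1: "2 * ln (1 + \<epsilon>) \<le> L + \<epsilon>\<^sup>2"
    using pos by (simp add: ln_realpow ln_mult L_def)
  have "ln (1 / (1 + 2 * \<epsilon>)) \<le> 1 / (1 + 2 * \<epsilon>) - 1" using pos by (intro ln_le_minus_one) auto
  then have "1 - 1 / (1 + 2 * \<epsilon>) \<le> L" using pos by (simp add: L_def ln_div)
  moreover have "\<epsilon> \<le> 1 - 1 / (1 + 2 * \<epsilon>)"
  proof -
    have "\<epsilon> * (1 + 2 * \<epsilon>) \<le> \<epsilon> * 2" using assms by (intro mult_left_mono) auto
    then show ?thesis using pos by (simp add: field_simps)
  qed
  ultimately have "\<epsilon> * \<epsilon> \<le> \<epsilon> * L" using assms by (intro mult_left_mono) auto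
  then have 2: "ln (1 + \<epsilon>) - (1/2 + \<epsilon>) * L \<le> - (\<epsilon>\<^sup>2 / 2)"
    using 1 by (simp add: algebra_simps power2_eq_square)
  have "((1 + (1 + 2 * \<epsilon>)) / 2) / (1 + 2 * \<epsilon>) powr (1/2 + \<epsilon>) = exp (ln (1 + \<epsilon>) - (1/2 + \<epsilon>) * L)"
  proof -
    have "(1 + (1 + 2 * \<epsilon>)) / 2 = 1 + \<epsilon>" by simp
    then show ?thesis using pos by (simp only: powr_def exp_diff L_def exp_ln) simp
  qed
  then show ?thesis using 2 by simp
qed

text \<open>With \<open>b = r * t\<close> and \<open>D = 3 * r\<close>, a factor 2^(-c) yields 2^(-3
  c r b) against about 2^(2 r b) choices of \<open>B\<close>, so any c above 2/3 would do; a
  threshold near 1 allows c near 1. Numerically the claim is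
  \<open>17/2 \<le> 2 powr (25/8)\<close>, checked on eighth powers.\<close>

lemma dense_factor_le: "((1 + 16) / 2) / 16 powr (31/32) \<le> (2::real) powr (- 3/4)"
proof -
  have "(17/2::real) \<le> 2 powr (25/8)"
  proof (rule power_le_imp_le_base)
    show "(17/2::real) ^ Suc 7 \<le> (2 powr (25/8)) ^ Suc 7"
      by (simp add: powr_power) (simp add: power_divide)
  qed auto
  also have "(25/8::real) = - 3/4 + 31/8" by simp
  also have "2 powr (- 3/4 + 31/8 :: real) = 2 powr (-3/4) * 2 powr (31/8)" by (rule powr_add)
  also have "2 powr (31/8) = (16::real) powr (31/32)"
    using powr_powr[of 2 4 "31/32"] by simp
  finally show ?thesis by (simp add: field_simps)
qed

text \<open>
  The parameters are \<open>s = 4 r\<close>, \<open>d = r\<close>, \<open>D = 3 r\<close>, \<open>t = 4 s 2\<^sup>s\<^sup>/\<^sup>2\<close>, \<open>\<theta> = 1/2 + 1/s\<close>, \<open>\<eta> = 31/32\<close>, \<open>m = s\<^sup>4\<close>.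
  The choice of \<open>D\<close> is constrained by \<open>(e n / (d t))\<^sup>d\<^sup>t\<close> being about \<open>2\<^sup>s\<^sup>d\<^sup>t\<^sup>/\<^sup>2\<close>, which the factor
  \<open>2\<^sup>-\<^sup>3\<^sup>d\<^sup>t\<^sup>D\<^sup>/\<^sup>4\<close> from \<open>dense_factor_le\<close> has to beat.
\<close>

lemma few_colors_bound:
  fixes n k r :: nat
  assumes n: "1 \<le> n" "k \<le> n" "32 * n \<le> 16 ^ r" and r: "1 \<le> r"
    and small: "256 * real r ^ 4 * (31/32) ^ r \<le> 1/8"
  shows "avg ([{1..n}]\<^bsup>2\<^esup>) (\<lambda>E. of_bool (\<exists>c. clique_coloring {1..n} E c \<and> card (c ` {1..n}) \<le> k))
    \<le> exp (256 * real r ^ 3 * 4 ^ r - 16 ^ r / 3)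
      + exp (256 * real r ^ 3 * 4 ^ r + 1024 * real r ^ 5 - 512 * real r ^ 4 * 4 ^ r)
      + 2 powr (12 * real r ^ 2 - 4 * real r ^ 3 * 4 ^ r)
      + real (n choose k) * (2 ^ (k * (64 * r\<^sup>2 * 4 ^ r)) * exp (- (real (n - k) / 2 ^ (k + 1))))"
proof -
  define s t m where "s = 4 * r" and "t = s * 2 ^ (2 * r + 2)" and "m = s ^ 4"
  have N: "32 * real n \<le> 16 ^ r"
    using n(3) of_nat_le_iff[of "32 * n" "16 ^ r", where 'a=real] by simp
  have two_s: "(2::real) ^ s = 16 ^ r" unfolding s_def power_mult by simp
  have four: "(2::nat) ^ (2 * r) = 4 ^ r" unfolding power_mult by simp
  have st: "s * t = 64 * r\<^sup>2 * 4 ^ r"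
    unfolding t_def s_def power_add four by (simp add: power2_eq_square)
  have rt: "r * t = 16 * r\<^sup>2 * 4 ^ r"
    unfolding t_def s_def power_add four by (simp add: power2_eq_square)
  have stR: "real (s * t) = 64 * real r ^ 2 * 4 ^ r" by (simp add: st)
  have rtR: "real (r * t) = 16 * real r ^ 2 * 4 ^ r" by (simp add: rt)
  have mR: "real m = 256 * real r ^ 4" by (simp add: m_def s_def power_mult_distrib)
  have sR: "real s = 4 * real r" by (simp add: s_def)
  have npow: "real n ^ j \<le> exp (4 * real r * j)" for j
  proof -
    have "real n \<le> 2 ^ s" unfolding two_s using N by linarith
    also have "\<dots> \<le> exp 1 ^ s"
      using exp_ge_add_one_self[of 1] by (intro power_mono) auto
    also have "\<dots> = exp (4 * real r)" by (simp add: s_def flip: exp_of_nat_mult)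
    finally have "real n ^ j \<le> exp (4 * real r) ^ j" by (intro power_mono) auto
    then show ?thesis by (simp add: mult.commute flip: exp_of_nat_mult)
  qed
  \<comment> \<open>As \<open>(1 + 2 / s) ^ s \<le> exp 2 \<le> 9\<close> and
    \<open>32 * n \<le> 2 ^ s\<close>, the first summand is at most 9/32; \<open>small\<close>
    leaves 1/8 for the second.\<close>
  have kill: "real n * (1/2 + 1/s) ^ s + real m * (31/32) ^ r \<le> 1/2"
  proof -
    have s0: "0 < s" using r by (simp add: s_def)
    have "(1/2 + 1/real s) ^ s = (1 + 2 / real s) ^ s / 2 ^ s"
      by (simp add: field_simps flip: power_divide)
    also have "\<dots> \<le> exp 2 / 2 ^ s"
      using exp_ge_one_plus_x_over_n_power_n[of s 2] s0 by (intro divide_right_mono) auto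
    also have "exp 2 = exp 1 * exp (1::real)" by (simp flip: exp_add)
    also have "\<dots> \<le> 3 * 3" using exp_le by (intro mult_mono) auto
    finally have "real n * (1/2 + 1/real s) ^ s \<le> real n * (9 / 2 ^ s)"
      by (intro mult_left_mono) (auto simp: divide_right_mono)
    also have "\<dots> \<le> 9 / 32" using N by (simp add: two_s field_simps)
    finally show ?thesis using small by (simp add: mR)
  qed
  have "avg ([{1..n}]\<^bsup>2\<^esup>) (\<lambda>E. of_bool (\<exists>c. clique_coloring {1..n} E c \<and> card (c ` {1..n}) \<le> k))
    \<le> real n ^ (t * s) * exp (- (2 ^ s / 3))
      + real ((n choose (s * t)) * (n choose m)) * (((1 + (1 + 2 * (1/s))) / 2) / (1 + 2 * (1/s)) powr (1/2 + 1/s)) ^ (s * t * m)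
      + real ((n choose (r * t)) * (n choose (3 * r))) * (((1 + 16) / 2) / 16 powr (31/32)) ^ (r * t * (3 * r))
      + real (n choose k) * (2 ^ (k * (s * t)) * exp (- (real (n - k) / 2 ^ (k + 1))))"
    by (rule prob_few_colors[where h = "2 * r"]) (use n r kill in \<open>auto simp: s_def t_def\<close>)
  also have "\<dots> \<le> exp (256 * real r ^ 3 * 4 ^ r - 16 ^ r / 3)
      + exp (256 * real r ^ 3 * 4 ^ r + 1024 * real r ^ 5 - 512 * real r ^ 4 * 4 ^ r)
      + 2 powr (12 * real r ^ 2 - 4 * real r ^ 3 * 4 ^ r)
      + real (n choose k) * (2 ^ (k * (64 * r\<^sup>2 * 4 ^ r)) * exp (- (real (n - k) / 2 ^ (k + 1))))"
  proof (intro add_mono)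
    have "real n ^ (t * s) * exp (- (2 ^ s / 3)) \<le> exp (4 * real r * real (t * s)) * exp (- (2 ^ s / 3))"
      by (intro mult_right_mono npow) auto
    also have "\<dots> = exp (256 * real r ^ 3 * 4 ^ r - 16 ^ r / 3)"
      unfolding mult.commute[of t s] stR two_s
      by (simp add: power2_eq_square power3_eq_cube mult_ac flip: exp_add)
    finally show "real n ^ (t * s) * exp (- (2 ^ s / 3)) \<le> exp (256 * real r ^ 3 * 4 ^ r - 16 ^ r / 3)" .
    let ?q = "((1 + (1 + 2 * (1/real s))) / 2) / (1 + 2 * (1/real s)) powr (1/2 + 1/real s)"
    have q: "0 \<le> ?q" "?q \<le> exp (- ((1/real s)\<^sup>2 / 2))"
      using bias_factor_le[of "1 / real s"] r by (auto simp: s_def)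
    have "real ((n choose (s * t)) * (n choose m)) \<le> exp (4 * real r * real (s * t)) * exp (4 * real r * real m)"
      unfolding of_nat_mult[of "n choose (s * t)"]
      by (intro mult_mono order_trans[OF choose_le_power npow]) auto
    moreover have "?q ^ (s * t * m) \<le> exp (- ((1/real s)\<^sup>2 / 2)) ^ (s * t * m)"
      using q by (intro power_mono) auto
    moreover have "exp (- ((1/real s)\<^sup>2 / 2)) ^ (s * t * m) = exp (- (512 * real r ^ 4 * 4 ^ r))"
    proof -
      have "real (s * t * m) * ((1/real s)\<^sup>2 / 2) = 512 * real r ^ 4 * 4 ^ r"
        unfolding of_nat_mult[of "s * t"] stR mR sR using r by (simp add: power2_eq_square field_simps)
      then show ?thesis by (simp flip: exp_of_nat_mult)
    qed
    ultimately have "real ((n choose (s * t)) * (n choose m)) * ?q ^ (s * t * m)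
        \<le> exp (4 * real r * real (s * t)) * exp (4 * real r * real m) * exp (- (512 * real r ^ 4 * 4 ^ r))"
      using q by (intro mult_mono) auto
    also have "\<dots> = exp (256 * real r ^ 3 * 4 ^ r + 1024 * real r ^ 5 - 512 * real r ^ 4 * 4 ^ r)"
      unfolding stR mR exp_add[symmetric] by (rule arg_cong[where f=exp]) (simp add: eval_nat_numeral algebra_simps)
    finally show "real ((n choose (s * t)) * (n choose m)) * ?q ^ (s * t * m)
      \<le> exp (256 * real r ^ 3 * 4 ^ r + 1024 * real r ^ 5 - 512 * real r ^ 4 * 4 ^ r)" .
    let ?b = "r * t"
    have b0: "0 < ?b" using r by (simp add: rt)
    \<comment> \<open>The cruder bound \<open>n ^ ?b\<close> would only give 2^(4 r b), which the
      factor 2^(-9 r b / 4) cannot beat. Dividing by \<open>?b\<close>, which is at least of order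
      sqrt n, halves the exponent.\<close>
    have "real (n choose ?b) \<le> real n ^ ?b / fact ?b" by (rule choose_le_power_div_fact)
    also have "\<dots> \<le> real n ^ ?b / (real ?b ^ ?b / exp ?b)"
      using power_le_exp_fact[of ?b] b0 by (intro divide_left_mono) (auto simp: field_simps)
    also have "\<dots> = (exp 1 * real n / ?b) ^ ?b"
      by (simp add: power_divide power_mult_distrib flip: exp_of_nat_mult)
    also have "\<dots> \<le> (2 powr (2 * real r)) ^ ?b"
    proof (intro power_mono)
      have four': "(4::real) ^ r * 4 ^ r = 16 ^ r" by (simp flip: power_mult_distrib)
      have "exp 1 * real n \<le> 3 * (16 ^ r / 32)" using N exp_le by (intro mult_mono) auto
      also have "\<dots> \<le> 16 * real r ^ 2 * 16 ^ r"
      proof -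
        have "1 \<le> real r ^ 2" using r by (intro one_le_power) auto
        then have "3 / 32 \<le> 16 * real r ^ 2" by linarith
        then have "3 / 32 * 16 ^ r \<le> 16 * real r ^ 2 * 16 ^ r" by (intro mult_right_mono) auto
        then show ?thesis by simp
      qed
      also have "\<dots> = 4 ^ r * real ?b" unfolding rtR four'[symmetric] by simp
      finally have "exp 1 * real n / ?b \<le> 4 ^ r" using b0 by (simp add: field_simps)
      moreover have "(4::real) ^ r = 2 powr (2 * real r)"
        using powr_realpow[of 2 "2 * r"] by (simp add: power_mult)
      ultimately show "exp 1 * real n / ?b \<le> 2 powr (2 * real r)" by simp
    qed auto
    also have "\<dots> = 2 powr (2 * real r * ?b)" by (simp add: powr_power mult.commute)
    finally have C1: "real (n choose ?b) \<le> 2 powr (2 * real r * ?b)" .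
    have "real (n choose (3 * r)) \<le> real n ^ (3 * r)" by (rule choose_le_power)
    also have "\<dots> \<le> (2 ^ s) ^ (3 * r)"
    proof (intro power_mono)
      show "real n \<le> 2 ^ s" unfolding two_s using N by linarith
    qed simp
    also have "\<dots> = 2 powr (12 * real r ^ 2)"
      unfolding power_mult[symmetric] s_def by (simp add: powr_realpow[symmetric] power2_eq_square)
    finally have C2: "real (n choose (3 * r)) \<le> 2 powr (12 * real r ^ 2)" .
    have "(((1 + 16) / 2) / 16 powr (31/32)) ^ (?b * (3 * r)) \<le> ((2::real) powr (- 3/4)) ^ (?b * (3 * r))"
      using dense_factor_le by (intro power_mono) auto
    also have "\<dots> = 2 powr (- (9/4) * (real ?b * real r))" by (simp add: powr_power mult_ac)
    finally have C3: "(((1 + 16) / 2) / 16 powr (31/32)) ^ (?b * (3 * r)) \<le> 2 powr (- (9/4) * (real ?b * real r))" .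
    have "real ((n choose ?b) * (n choose (3 * r))) * (((1 + 16) / 2) / 16 powr (31/32)) ^ (?b * (3 * r))
        \<le> 2 powr (2 * real r * ?b) * 2 powr (12 * real r ^ 2) * 2 powr (- (9/4) * (real ?b * real r))"
      unfolding of_nat_mult[of "n choose ?b"] by (intro mult_mono C1 C2 C3) auto
    also have "\<dots> = 2 powr (12 * real r ^ 2 - 4 * real r ^ 3 * 4 ^ r)"
      unfolding powr_add[symmetric] rtR
      by (rule arg_cong[where f="\<lambda>x. 2 powr x"]) (simp add: eval_nat_numeral algebra_simps)
    finally show "real ((n choose ?b) * (n choose (3 * r))) * (((1 + 16) / 2) / 16 powr (31/32)) ^ (?b * (3 * r))
      \<le> 2 powr (12 * real r ^ 2 - 4 * real r ^ 3 * 4 ^ r)" .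
  qed (simp add: st)
  finally show ?thesis .
qed

lemma lower_tendsto:
  fixes \<delta> :: real
  assumes \<delta>: "0 < \<delta>"
  shows "(\<lambda>n::nat. avg ([{1..n}]\<^bsup>2\<^esup>) (\<lambda>E. of_bool (\<exists>c. clique_coloring {1..n} E c
      \<and> real (card (c ` {1..n})) < 1/2 * log 2 (real n) - (3 + \<delta>) * log 2 (ln (real n))))) \<longlonglongrightarrow> 0"
    (is "(\<lambda>n. ?P n) \<longlonglongrightarrow> 0")
proof (rule tendsto_sandwich[OF _ _ tendsto_const])
  show "\<forall>\<^sub>F n in sequentially. 0 \<le> ?P n" by (intro always_eventually allI avg_nonneg) auto
  define f where "f r = exp (256 * real r ^ 3 * 4 ^ r - 16 ^ r / 3)
      + exp (256 * real r ^ 3 * 4 ^ r + 1024 * real r ^ 5 - 512 * real r ^ 4 * 4 ^ r)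
      + 2 powr (12 * real r ^ 2 - 4 * real r ^ 3 * 4 ^ r)" for r :: nat
  \<comment> \<open>The least \<open>r\<close> with \<open>16 ^ r \<ge> 32 * n\<close>; rounding up
    costs at most a factor 16, so \<open>16 ^ r \<le> 512 * n\<close>.\<close>
  define r where "r n = nat \<lceil>(log 2 (real n) + 5) / 4\<rceil>" for n :: nat
  define \<kappa> where "\<kappa> n = 1/2 * log 2 (real n) - (3 + \<delta>) * log 2 (ln (real n))" for n
  have r_top: "filterlim r at_top sequentially"
    unfolding r_def by real_asymp
  have "f \<longlonglongrightarrow> 0" unfolding f_def by real_asymp
  then have "(\<lambda>n. f (r n)) \<longlonglongrightarrow> 0" using r_top by (rule filterlim_compose)
  moreover have "(\<lambda>n. exp (- sqrt (real n))) \<longlonglongrightarrow> 0" by real_asymp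
  ultimately show "(\<lambda>n. f (r n) + exp (- sqrt (real n))) \<longlonglongrightarrow> 0"
    using tendsto_add[of "\<lambda>n. f (r n)" 0 sequentially] by fastforce
  have "\<forall>\<^sub>F r in sequentially. 256 * real r ^ 4 * (31/32) ^ r \<le> 1/8" by real_asymp
  then have "\<forall>\<^sub>F n in sequentially. 256 * real (r n) ^ 4 * (31/32) ^ r n \<le> 1/8"
    using r_top by (rule eventually_compose_filterlim)
  moreover have "\<forall>\<^sub>F n in sequentially. 0 \<le> \<kappa> n" unfolding \<kappa>_def using \<delta> by real_asymp
  moreover have "\<forall>\<^sub>F n in sequentially. 18 < ln (real n)" by real_asymp
  moreover have "\<forall>\<^sub>F n in sequentially. 1480 \<le> ln (real n) powr \<delta>" using \<delta> by real_asymp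
  moreover have "\<forall>\<^sub>F n in sequentially. 16 \<le> (n::nat)" by (rule eventually_ge_at_top)
  ultimately show "\<forall>\<^sub>F n in sequentially. ?P n \<le> f (r n) + exp (- sqrt (real n))"
  proof eventually_elim
    case (elim n)
    define k where "k = nat \<lfloor>\<kappa> n\<rfloor>"
    define l where "l = ln (real n)"
    have n0: "0 < n" using elim by simp
    have l18: "18 < l" using elim by (simp add: l_def)
    have k: "real k \<le> \<kappa> n" using elim(2) by (simp add: k_def)
    have loglog: "0 \<le> log 2 l" using l18 by simp
    have log_le: "log 2 n \<le> 3/2 * l"
    proof -
      have "l * 1 \<le> l * (3/2 * ln 2)" using l18 ln2_ge_two_thirds by (intro mult_left_mono) auto
      then show ?thesis by (simp add: log_def l_def field_simps)
    qed
    have kl: "real k \<le> l"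
    proof -
      have "0 \<le> (3 + \<delta>) * log 2 l" using loglog \<delta> by (intro mult_nonneg_nonneg) auto
      then have "real k \<le> 1/2 * log 2 n" using k by (simp add: \<kappa>_def l_def)
      then show ?thesis using log_le l18 by linarith
    qed
    have r4: "log 2 n + 5 \<le> 4 * real (r n)" "4 * real (r n) \<le> log 2 n + 9"
    proof -
      have "0 \<le> log 2 n" using n0 by simp
      then have "real (r n) = of_int \<lceil>(log 2 (real n) + 5) / 4\<rceil>" by (simp add: r_def)
      then show "log 2 n + 5 \<le> 4 * real (r n)" "4 * real (r n) \<le> log 2 n + 9"
        using conjunct1[OF ceiling_correct[of "(log 2 (real n) + 5) / 4"]]
          conjunct2[OF ceiling_correct[of "(log 2 (real n) + 5) / 4"]] by argo+
    qed
    have pow16: "(16::real) ^ r n = 2 powr (4 * real (r n))"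
      using powr_realpow[of 2 "4 * r n"] by (simp add: power_mult)
    have lo: "32 * real n \<le> 16 ^ r n"
    proof -
      have "32 * real n = 2 powr (log 2 n + 5)" using n0 by (simp add: powr_add)
      also have "\<dots> \<le> 16 ^ r n" unfolding pow16 using r4 by (intro powr_mono) auto
      finally show ?thesis .
    qed
    have hi: "16 ^ r n \<le> 512 * real n"
    proof -
      have "16 ^ r n \<le> 2 powr (log 2 n + 9)" unfolding pow16 using r4 by (intro powr_mono) auto
      also have "\<dots> = 512 * real n" using n0 by (simp add: powr_add)
      finally show ?thesis .
    qed
    have "real (32 * n) \<le> real (16 ^ r n)" using lo by simp
    then have loN: "32 * n \<le> 16 ^ r n" by (simp only: of_nat_le_iff)
    have "0 \<le> log 2 n" using n0 by simp
    then have "0 < real (r n)" using r4(1) by linarith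
    then have r1: "1 \<le> r n" by simp
    have sqn: "4 \<le> sqrt n" "4 * sqrt n \<le> n"
    proof -
      show "4 \<le> sqrt n" using elim(5) by (intro real_le_rsqrt) auto
      then have "4 * sqrt n \<le> sqrt n * sqrt n" by (intro mult_right_mono) auto
      then show "4 * sqrt n \<le> n" by simp
    qed
    have k2: "2 ^ k \<le> sqrt n / l powr (3 + \<delta>)"
    proof -
      have "2 ^ k = 2 powr real k" by (simp add: powr_realpow)
      also have "\<dots> \<le> 2 powr \<kappa> n" using k by (intro powr_mono) auto
      also have "\<dots> = sqrt n / l powr (3 + \<delta>)"
        unfolding \<kappa>_def l_def using elim(3) by (intro powr_log_ln) auto
      finally show ?thesis .
    qed
    have l3: "1 \<le> l powr (3 + \<delta>)" using l18 \<delta> by (intro ge_one_powr_ge_zero) auto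
    have "2 ^ k \<le> sqrt n"
    proof (rule order_trans[OF k2])
      have "sqrt n / l powr (3 + \<delta>) \<le> sqrt n / 1"
        using l3 by (intro divide_left_mono) auto
      then show "sqrt n / l powr (3 + \<delta>) \<le> sqrt n" by simp
    qed
    moreover have "real k \<le> 2 ^ k" using of_nat_less_two_power[of k] by (simp add: less_imp_le)
    ultimately have kn: "real k \<le> n / 4" using sqn by linarith
    then have kn': "k \<le> n" by linarith
    have F4: "real (n choose k) * (2 ^ (k * (64 * (r n)\<^sup>2 * 4 ^ r n)) * exp (- (real (n - k) / 2 ^ (k + 1))))
        \<le> exp (- sqrt n)"
    proof -
      \<comment> \<open>The order of \<open>k * (s * t)\<close>: one factor \<open>l\<close> from
        the number of colours, one from the number of parts and one from the part size.\<close>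
      define X where "X = l ^ 3 * sqrt n"
      have X0: "0 \<le> X" using l18 by (simp add: X_def)
      have "real (n choose k) \<le> real n ^ k" by (rule choose_le_power)
      also have "\<dots> = exp (k * l)" using n0 by (simp add: l_def exp_of_nat_mult)
      also have "\<dots> \<le> exp X"
      proof (intro exp_le_cancel_iff[THEN iffD2])
        have "k * l \<le> l * l" using kl l18 by (intro mult_right_mono) auto
        also have "\<dots> = l * l * 1" by simp
        also have "\<dots> \<le> l * l * (l * sqrt n)"
        proof (intro mult_left_mono)
          have "1 * 1 \<le> l * sqrt n" using l18 sqn(1) by (intro mult_mono) linarith+
          then show "1 \<le> l * sqrt n" by simp
        qed simp
        finally show "k * l \<le> X" by (simp add: X_def power3_eq_cube)
      qed
      finally have a: "real (n choose k) \<le> exp X" .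
      have "(4::real) ^ r n \<le> 23 * sqrt n"
      proof (rule power2_le_imp_le)
        have "((4::real) ^ r n)\<^sup>2 = 16 ^ r n" by (simp add: power2_eq_square flip: power_mult_distrib)
        also have "\<dots> \<le> 529 * real n" using hi by simp
        finally show "((4::real) ^ r n)\<^sup>2 \<le> (23 * sqrt n)\<^sup>2" by (simp add: power_mult_distrib)
      qed auto
      moreover have "real (r n) \<le> l / 2" using r4(2) log_le l18 by linarith
      then have "real (r n) ^ 2 \<le> (l / 2) ^ 2" by (intro power_mono) auto
      ultimately have h: "64 * real (r n) ^ 2 * 4 ^ r n \<le> 64 * (l / 2) ^ 2 * (23 * sqrt n)"
        by (intro mult_mono) auto
      have "k * (64 * real (r n) ^ 2 * 4 ^ r n) \<le> l * (64 * (l / 2) ^ 2 * (23 * sqrt n))"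
        by (rule mult_mono[OF kl h]) (use l18 in auto)
      also have "\<dots> = 368 * X" by (simp add: X_def power2_eq_square power3_eq_cube)
      finally have kst: "real (k * (64 * (r n)\<^sup>2 * 4 ^ r n)) \<le> 368 * X" by simp
      have "(2::real) ^ (k * (64 * (r n)\<^sup>2 * 4 ^ r n)) \<le> exp 1 ^ (k * (64 * (r n)\<^sup>2 * 4 ^ r n))"
        using exp_ge_add_one_self[of 1] by (intro power_mono) auto
      also have "\<dots> = exp (real (k * (64 * (r n)\<^sup>2 * 4 ^ r n)))"
        by (simp only: exp_of_nat_mult[of _ 1, symmetric] mult_1_right)
      also have "\<dots> \<le> exp (368 * X)" using kst by simp
      finally have b: "(2::real) ^ (k * (64 * (r n)\<^sup>2 * 4 ^ r n)) \<le> exp (368 * X)" .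
      \<comment> \<open>Here \<open>3 + \<delta>\<close> is used: \<open>n / 2 ^ k\<close> exceeds
        \<open>X\<close> by a factor \<open>l powr \<delta>\<close>, which absorbs
        \<open>1480 = 4 * 370\<close>. Of the 370, one \<open>X\<close> pays for the binomial
        coefficient, 368 for the power of two, and one is left over.\<close>
      have "370 * X \<le> X * l powr \<delta> / 4"
        using elim(4) X0 mult_left_mono[of 1480 "l powr \<delta>" X] by (simp add: l_def)
      also have "X * l powr \<delta> = sqrt n * l powr (3 + \<delta>)"
        using l18 powr_realpow[of l 3] by (simp add: X_def powr_add)
      also have "sqrt n * l powr (3 + \<delta>) / 4 = (n / 2) * (1 / (2 * (sqrt n / l powr (3 + \<delta>))))"
        using n0 l18 by (simp add: field_simps)
      also have "\<dots> \<le> real (n - k) * (1 / (2 * 2 ^ k))"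
        using kn k2 n0 l18 by (intro mult_mono divide_left_mono) (auto simp: of_nat_diff)
      finally have c: "370 * X \<le> real (n - k) / 2 ^ (k + 1)" by simp
      have "real (n choose k) * (2 ^ (k * (64 * (r n)\<^sup>2 * 4 ^ r n)) * exp (- (real (n - k) / 2 ^ (k + 1))))
          \<le> exp X * (exp (368 * X) * exp (- (370 * X)))"
        using a b c by (intro mult_mono) auto
      also have "\<dots> = exp (- X)" by (simp flip: exp_add)
      also have "\<dots> \<le> exp (- sqrt n)"
        using l18 one_le_power[of l 3] mult_right_mono[of 1 "l ^ 3" "sqrt n"] by (simp add: X_def)
      finally show ?thesis .
    qed
    have "?P n \<le> avg ([{1..n}]\<^bsup>2\<^esup>) (\<lambda>E. of_bool (\<exists>c. clique_coloring {1..n} E c \<and> card (c ` {1..n}) \<le> k))"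
    proof (rule avg_mono)
      fix E
      have "card (c ` {1..n}) \<le> k" if "real (card (c ` {1..n})) < \<kappa> n" for c :: "nat \<Rightarrow> nat"
        using that unfolding k_def by (simp add: le_nat_floor)
      then show "(of_bool (\<exists>c. clique_coloring {1..n} E c \<and> real (card (c ` {1..n})) < 1/2 * log 2 (real n) - (3 + \<delta>) * log 2 (ln (real n))) :: real)
        \<le> of_bool (\<exists>c. clique_coloring {1..n} E c \<and> card (c ` {1..n}) \<le> k)"
        unfolding of_bool_def \<kappa>_def by auto
    qed
    also have "\<dots> \<le> f (r n) + real (n choose k) * (2 ^ (k * (64 * (r n)\<^sup>2 * 4 ^ r n)) * exp (- (real (n - k) / 2 ^ (k + 1))))"
      unfolding f_def by (rule few_colors_bound[OF _ kn' loN r1 elim(1)]) (use n0 in simp)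
    finally show ?case using F4 by linarith
  qed
qed

theorem theorem1:
  fixes \<delta> :: real
  assumes "\<delta> > 0"
  shows "(\<lambda>n::nat. measure_pmf.prob (binomial_random_graph n (1 / 2))
            {E. 1 / 2 * log 2 (real n) - (3 + \<delta>) * log 2 (ln (real n))
                  \<le> real (clique_chromatic_number {1..n} E)
              \<and> real (clique_chromatic_number {1..n} E)
                  \<le> 1 / 2 * log 2 (real n) - (1 / 2 - \<delta>) * log 2 (ln (real n))})
         \<longlonglongrightarrow> 1"
proof -
  \<comment> \<open>The upper bound is available for parameters below 1/2 only; a smaller parameter
    gives a stronger bound as soon as \<open>log 2 (ln n)\<close> is nonnegative.\<close>
  define \<epsilon> where "\<epsilon> = min \<delta> (1/4)"
  have \<epsilon>: "0 < \<epsilon>" "\<epsilon> < 1/2" "\<epsilon> \<le> \<delta>" using assms by (auto simp: \<epsilon>_def)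
  define lo hi where "lo n = 1/2 * log 2 (real n) - (3 + \<delta>) * log 2 (ln (real n))"
    and "hi n = 1/2 * log 2 (real n) - (1/2 - \<epsilon>) * log 2 (ln (real n))" for n :: nat
  define S where "S n = [{1..n}]\<^bsup>2\<^esup>" for n :: nat
  define col where "col n E c \<longleftrightarrow> clique_coloring {1..n} E c" for n :: nat and E and c :: "nat \<Rightarrow> nat"
  define num where "num n c = real (card (c ` {1..n}))" for n :: nat and c :: "nat \<Rightarrow> nat"
  define cn where "cn n E = real (clique_chromatic_number {1..n} E)" for n :: nat and E
  define A where "A n = avg (S n) (\<lambda>E. of_bool (\<not> (\<exists>c. col n E c \<and> num n c \<le> hi n)))" for n
  define B where "B n = avg (S n) (\<lambda>E. of_bool (\<exists>c. col n E c \<and> num n c < lo n))" for n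
  define P where "P n = avg (S n) (\<lambda>E. of_bool (lo n \<le> cn n E \<and> cn n E \<le> 1/2 * log 2 (real n) - (1/2 - \<delta>) * log 2 (ln (real n))))" for n
  have finS: "finite (S n)" for n unfolding S_def by (intro finite_imp_finite_nsets) simp
  have "A \<longlonglongrightarrow> 0"
    unfolding A_def S_def col_def num_def hi_def by (rule upper_tendsto) (use \<epsilon> in auto)
  moreover have "B \<longlonglongrightarrow> 0"
    unfolding B_def S_def col_def num_def lo_def by (rule lower_tendsto[OF assms])
  ultimately have lim: "(\<lambda>n. 1 - (A n + B n)) \<longlonglongrightarrow> 1"
    using tendsto_diff[OF tendsto_const[of 1] tendsto_add[of A 0 sequentially B 0]] by simp
  have "\<forall>\<^sub>F n in sequentially. 1 < ln (real n)" by real_asymp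
  then have "\<forall>\<^sub>F n in sequentially. 1 - (A n + B n) \<le> P n"
  proof eventually_elim
    case (elim n)
    have hi: "hi n \<le> 1/2 * log 2 (real n) - (1/2 - \<delta>) * log 2 (ln (real n))"
      unfolding hi_def using elim \<epsilon> by (intro diff_left_mono mult_right_mono) auto
    have "1 - (A n + B n) = avg (S n) (\<lambda>E. 1 - (of_bool (\<not> (\<exists>c. col n E c \<and> num n c \<le> hi n))
        + of_bool (\<exists>c. col n E c \<and> num n c < lo n)))"
      unfolding avg_diff avg_add A_def B_def using finS by simp
    also have "\<dots> \<le> P n"
      unfolding P_def
    proof (rule avg_mono)
      fix E
      have "lo n \<le> cn n E \<and> cn n E \<le> hi n"
        if c: "col n E c" "num n c \<le> hi n" and low: "\<And>c. col n E c \<Longrightarrow> lo n \<le> num n c" for c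
      proof -
        \<comment> \<open>The colouring \<open>c\<close> makes the set nonempty, so its infimum is
          attained by a colouring instead of being the default value 0, and \<open>low\<close>
          applies to it.\<close>
        let ?X = "{card (c ` {1..n}) | c. clique_coloring {1..n} E c}"
        have "card (c ` {1..n}) \<in> ?X" using c(1) by (auto simp: col_def)
        then have "Inf ?X \<in> ?X" "Inf ?X \<le> card (c ` {1..n})"
          by (rule wellorder_InfI, rule wellorder_Inf_le1)
        then show ?thesis
          using c(2) low unfolding cn_def clique_chromatic_number_def num_def col_def by fastforce
      qed
      then have "lo n \<le> cn n E \<and> cn n E \<le> 1/2 * log 2 (real n) - (1/2 - \<delta>) * log 2 (ln (real n))"
        if "\<exists>c. col n E c \<and> num n c \<le> hi n" "\<not> (\<exists>c. col n E c \<and> num n c < lo n)"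
        using that hi by (meson not_less order_trans)
      then show "1 - (of_bool (\<not> (\<exists>c. col n E c \<and> num n c \<le> hi n)) + of_bool (\<exists>c. col n E c \<and> num n c < lo n))
        \<le> (of_bool (lo n \<le> cn n E \<and> cn n E \<le> 1/2 * log 2 (real n) - (1/2 - \<delta>) * log 2 (ln (real n))) :: real)"
        unfolding of_bool_def by (simp split: if_splits)
    qed
    finally show ?case .
  qed
  moreover have "P n \<le> 1" for n
  proof -
    have "P n \<le> avg (S n) (\<lambda>_. 1)" unfolding P_def by (intro avg_mono) auto
    then show ?thesis using finS by simp
  qed
  ultimately have "P \<longlonglongrightarrow> 1"
    by (intro tendsto_sandwich[OF _ _ lim tendsto_const]) auto
  then show ?thesis
    unfolding prob_binomial_random_graph P_def cn_def lo_def S_def .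
qed

end
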